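(* Let $1\le j\le 6$ and let $G_1, G_2, H_1, H_2$ be finite groups such that $G_1\times G_2\sim_{j}H_1\times H_2$. If $\# G_i=\# H_i$ for $i=1, 2$ and $\gcd(\# G_1, \# G_2)=1$, then $G_i\sim_j H_i$ for $i=1, 2$.
   Context: For a finite group $G$, $\# G$ is its order and $\mathrm{ord}(g)$ is the order of $g\in G$. - $\mathcal O(G)$ is the multiset $\{\mathrm{ord}(g): g\in G\}$ of orders of elements of $G$ (counted with multiplicity). - $\mathcal C_G$ is the set of all cyclic subgroups of $G$. $\Lambda(G)$ is the vertex-weighted digraph with vertex set $\mathcal C_G$, each vertex $C$ weighted by its order $\# C$, with a directed edge $C_1\to C_2$ whenever $C_2\subsetneq C_1$. - The power graph $\Gamma(G)$ is the undirected graph with vertex set $G$ in which $g,h$ are connected if $g\neq h$ and $g=h^k$ or $h=g^k$ for some integer $k$. - For $t\in\mathbb Z$, $\Gamma_t(G)$ is the directed graph with vertex set $G$ and edge set $\{g\to g^t: g\in G\}$ (loops allowed). Equivalence relations on finite groups $G,H$: (1) $G\sim_1 H$ if $G\cong H$ as groups; (2) $G\sim_2 H$ if there is a bijection $\varphi:G\to H$ with $\varphi(g^t)=\varphi(g)^t$ for all $g\in G$, $t\in\mathbb Z$; (3) $G\sim_3 H$ if $\Lambda(G)\cong\Lambda(H)$ as vertex-weighted digraphs; (4) $G\sim_4 H$ if $\Gamma(G)\cong\Gamma(H)$; (5) $G\sim_5 H$ if $\Gamma_t(G)\cong\Gamma_t(H)$ for every $t\in\mathbb Z$; (6) $G\sim_6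 H$ if $\mathcal O(G)=\mathcal O(H)$. *)

theory Defs
  imports
    "HOL-Algebra.Elementary_Groups"
    "HOL-Algebra.Multiplicative_Group"
    "HOL-Library.Multiset"
    "Graph_Theory.Pair_Digraph"
    "Graph_Theory.Digraph_Isomorphism"
begin

definition order_multiset :: "('a, 'm) monoid_scheme \<Rightarrow> nat multiset" where
  "order_multiset G = image_mset (group.ord G) (mset_set (carrier G))"

definition cyclic_subgroups :: "('a, 'm) monoid_scheme \<Rightarrow> 'a set set" where
  "cyclic_subgroups G = {C. subgroup C G \<and> cyclic_group (G\<lparr>carrier := C\<rparr>)}"

text \<open>The vertex weights are not part of the digraph; they are accounted for in the
  notion of isomorphism below.\<close>

definition cyclic_subgroup_digraph :: "('a, 'm) monoid_scheme \<Rightarrow> 'a set pair_pre_digraph" where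
  "cyclic_subgroup_digraph G =
     \<lparr>pverts = cyclic_subgroups G,
      parcs = {(C1, C2). C1 \<in> cyclic_subgroups G \<and> C2 \<in> cyclic_subgroups G \<and> C2 \<subset> C1}\<rparr>"

definition weighted_digraph_iso ::
  "('a \<Rightarrow> nat) \<Rightarrow> ('a, 'b) pre_digraph \<Rightarrow> ('c \<Rightarrow> nat) \<Rightarrow> ('c, 'd) pre_digraph \<Rightarrow> bool" where
  "weighted_digraph_iso w D w' D' \<longleftrightarrow>
     (\<exists>f. pre_digraph.digraph_isomorphism D f \<and> D' = app_iso f D \<and>
          (\<forall>v \<in> verts D. w' (iso_verts f v) = w v))"

text \<open>As usual in this library, an undirected graph is a symmetric digraph.\<close>

definition power_graph :: "('a, 'm) monoid_scheme \<Rightarrow> 'a pair_pre_digraph" where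
  "power_graph G =
     \<lparr>pverts = carrier G,
      parcs = {(g, h). g \<in> carrier G \<and> h \<in> carrier G \<and> g \<noteq> h \<and>
                 (\<exists>k::int. g = h [^]\<^bsub>G\<^esub> k \<or> h = g [^]\<^bsub>G\<^esub> k)}\<rparr>"

definition power_map_digraph :: "int \<Rightarrow> ('a, 'm) monoid_scheme \<Rightarrow> 'a pair_pre_digraph" where
  "power_map_digraph t G =
     \<lparr>pverts = carrier G, parcs = {(g, g [^]\<^bsub>G\<^esub> t) | g. g \<in> carrier G}\<rparr>"

definition power_equivalent :: "('a, 'm) monoid_scheme \<Rightarrow> ('b, 'n) monoid_scheme \<Rightarrow> bool" where
  "power_equivalent G H \<longleftrightarrow>
     (\<exists>\<phi>. bij_betw \<phi> (carrier G) (carrier H) \<and>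
          (\<forall>g \<in> carrier G. \<forall>t::int. \<phi> (g [^]\<^bsub>G\<^esub> t) = \<phi> g [^]\<^bsub>H\<^esub> t))"

definition group_sim :: "nat \<Rightarrow> ('a, 'm) monoid_scheme \<Rightarrow> ('b, 'n) monoid_scheme \<Rightarrow> bool" where
  "group_sim j G H \<longleftrightarrow>
     j = 1 \<and> G \<cong> H \<or>
     j = 2 \<and> power_equivalent G H \<or>
     j = 3 \<and> weighted_digraph_iso card (with_proj (cyclic_subgroup_digraph G))
               card (with_proj (cyclic_subgroup_digraph H)) \<or>
     j = 4 \<and> digraph_iso (with_proj (power_graph G)) (with_proj (power_graph H)) \<or>
     j = 5 \<and> (\<forall>t::int. digraph_iso (with_proj (power_map_digraph t G))
               (with_proj (power_map_digraph t H))) \<or>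
     j = 6 \<and> order_multiset G = order_multiset H"

text \<open>\<^const>\<open>digraph_iso\<close> presupposes well-formed digraphs.\<close>

lemma wf_cyclic_subgroup_digraph: "wf_digraph (with_proj (cyclic_subgroup_digraph G))"
  by unfold_locales (auto simp: cyclic_subgroup_digraph_def)

lemma sym_power_graph:
  "wf_digraph (with_proj (power_graph G))" "symmetric (with_proj (power_graph G))"
proof -
  show "wf_digraph (with_proj (power_graph G))"
    by unfold_locales (auto simp: power_graph_def)
  have "arcs_ends (with_proj (power_graph G)) = parcs (power_graph G)"
    by (simp add: arcs_ends_def arc_to_ends_def)
  moreover have "sym (parcs (power_graph G))"
    by (rule symI) (auto simp only: power_graph_def pair_pre_digraph.select_convs mem_Collect_eq case_prod_conv)
  ultimately show "symmetric (with_proj (power_graph G))"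
    by (simp add: symmetric_def)
qed

lemma (in group) wf_power_map_digraph: "wf_digraph (with_proj (power_map_digraph t G))"
  by unfold_locales (auto simp: power_map_digraph_def)

lemma (in group) cyclic_subgroups_eq: "cyclic_subgroups G = (\<lambda>g. generate G {g}) ` carrier G"
proof -
  have "C \<in> cyclic_subgroups G \<longleftrightarrow> (\<exists>g \<in> carrier G. C = generate G {g})" for C
  proof
    assume "C \<in> cyclic_subgroups G"
    then have C: "subgroup C G" "cyclic_group (G\<lparr>carrier := C\<rparr>)"
      by (auto simp: cyclic_subgroups_def)
    then obtain g where g: "g \<in> C" "C = range (\<lambda>n::int. g [^]\<^bsub>G\<lparr>carrier := C\<rparr>\<^esub> n)"
      using group.cyclic_group[OF subgroup_imp_group[OF C(1)]] by auto
    then have "g \<in> carrier G" "C = range (\<lambda>n::int. g [^] n)"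
      using subgroup.subset[OF C(1)] int_pow_consistent[OF C(1) g(1)] by auto
    then show "\<exists>g \<in> carrier G. C = generate G {g}"
      using generate_pow by (auto simp: full_SetCompr_eq)
  next
    assume "\<exists>g \<in> carrier G. C = generate G {g}"
    then obtain g where g: "g \<in> carrier G" "C = generate G {g}" by blast
    then have "G\<lparr>carrier := C\<rparr> = subgroup_generated G {g}"
      by (simp add: subgroup_generated_def)
    with g show "C \<in> cyclic_subgroups G"
      by (simp add: cyclic_subgroups_def cyclic_group_generated generate_is_subgroup)
  qed
  then show ?thesis by auto
qed

end

theory Submission
  imports Defs "HOL-Number_Theory.Totient" "HOL-Algebra.Sylow"
begin

text \<open>
  Let \<open>n\<close> and \<open>m\<close> be the orders of the two factors. Since they are coprime, the first factor of
  the product is the set of \<open>n\<close>-torsion elements, and likewise for the second factor and \<open>m\<close>. So it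
  suffices that each kind of equivalence determines the torsion sets together with their structure.

  For isomorphisms and power-preserving bijections this holds because \<open>n\<close>-torsion is expressed
  by powers. For order multisets, one keeps the divisors of \<open>n\<close>; for the digraph of cyclic
  subgroups, one keeps the vertices whose weight divides \<open>n\<close>.

  For the graph of the power map with exponent \<open>t\<close>, take an exponent congruent to \<open>t\<close> modulo \<open>n\<close>
  and to \<open>0\<close> modulo \<open>m\<close>. On the product, its graph is the graph of the first factor with
  additional leaves, \<open>m\<close> times as many predecessors for each vertex. Such an inflation can be undone
  (\<open>inflation_conjugacy_cancel\<close>): the images of the maps are conjugate, and counting predecessors
  gives the number of missing leaves.

  For power graphs, an isomorphism need not preserve element orders: elements of different orders may
  be twins, that is, have the same closed neighbourhood. Nevertheless, if both factors are
  nontrivial, it preserves \<open>n\<close>-torsion outside the set of dominating vertices. The reason is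
  that twins of a non-dominating vertex have equal orders or orders that are powers of one prime
  (\<open>prime_power_nbrs\<close>), so all of them are \<open>n\<close>-torsion or none is; and that the largest order in a
  twin class can be read off the graph (\<open>graph_ord_eq\<close>). For the latter one recovers
  from the sizes of twin classes which of two adjacent non-twins is a power of the other
  (\<open>graph_below_iff\<close>) and then counts the elements of a cyclic subgroup. Finally, the only dominating
  \<open>n\<close>-torsion element is the identity, so an isomorphism of power graphs restricts to the
  torsion sets after sending the identity to the identity
  (\<open>restrict_comparability_iso_to_torsion\<close>).
\<close>

section \<open>Prime powers and totients\<close>

text \<open>In the divisor lattice of \<open>n\<close>, call two divisors comparable if one divides the other.
If two different divisors \<open>b dvd a\<close> with \<open>b \<noteq> 1\<close> are comparable with the same
divisors, then \<open>n\<close> is a prime power. Indeed, let \<open>p\<close> divide \<open>a div b\<close>;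
the smallest power of \<open>p\<close> that does not divide \<open>b\<close> divides \<open>a\<close>, so it is
comparable with \<open>b\<close>, hence a multiple of it, and \<open>b\<close> is a power of \<open>p\<close>. A
second prime \<open>q\<close> dividing \<open>n\<close> would make \<open>b * q\<close> comparable with
\<open>b\<close> but not with \<open>a\<close>, unless \<open>q\<close> divides \<open>a\<close>; but then
\<open>q\<close> itself is comparable with \<open>a\<close> and not with \<open>b\<close>.\<close>
lemma prime_power_if_comparable_divisors_agree:
  fixes a b n :: nat
  assumes n: "n > 0" and "b dvd a" "a dvd n" "b \<noteq> a" "b \<noteq> 1"
    and agree: "\<And>d. d dvd n \<Longrightarrow> d dvd b \<or> b dvd d \<longleftrightarrow> d dvd a \<or> a dvd d"
  obtains p k where "prime p" "n = p ^ k" "p dvd b"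
proof -
  obtain c where c: "a = b * c" using \<open>b dvd a\<close> by blast
  have pos: "a > 0" "b > 0" "c > 0" using n \<open>a dvd n\<close> c by (auto intro: Nat.gr0I)
  have "c \<noteq> 1" using c \<open>b \<noteq> a\<close> by auto
  then obtain p where p: "prime p" "p dvd c" using prime_factor_nat by blast
  have pb: "p * b dvd a" using p(2) c by (simp add: mult.commute mult_dvd_mono)
  define i where "i = multiplicity p b"
  have "p ^ Suc i dvd a"
    using multiplicity_dvd[of p b] pb by (metis dvd_trans i_def mult_dvd_mono dvd_refl power_Suc)
  then have "p ^ Suc i dvd b \<or> b dvd p ^ Suc i"
    using agree[of "p ^ Suc i"] \<open>a dvd n\<close> dvd_trans by blast
  moreover have "\<not> p ^ Suc i dvd b"
    using pos p(1) not_prime_unit by (subst power_dvd_iff_le_multiplicity) (auto simp: i_def)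
  ultimately obtain j where j: "b = p ^ j"
    using divides_primepow_nat[OF p(1)] by blast
  then have pdvdb: "p dvd b" using \<open>b \<noteq> 1\<close> by (metis dvd_power gr0I power_0)
  have "q = p" if q: "prime q" "q dvd n" for q
  proof (rule ccontr)
    assume "q \<noteq> p"
    then have qb: "\<not> q dvd b" using j q(1) p(1) by (metis prime_dvd_power primes_dvd_imp_eq)
    have copr: "coprime b q"
      using prime_imp_coprime[OF q(1) qb] by (metis coprime_commute)
    then have "b * q dvd n"
      using \<open>b dvd a\<close> \<open>a dvd n\<close> q(2) by (meson divides_mult dvd_trans)
    then have "b * q dvd a \<or> a dvd b * q" using agree by fastforce
    then show False
    proof
      assume "b * q dvd a"
      then have "q dvd a" by (meson dvd_mult_right)
      then have "q dvd b \<or> b dvd q" using agree q(2) by blast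
      then have "p dvd q" using qb pdvdb dvd_trans by blast
      then show False using \<open>q \<noteq> p\<close> p(1) q(1) primes_dvd_imp_eq by blast
    next
      assume "a dvd b * q"
      then have "b * p dvd b * q" using pb by (metis dvd_trans mult.commute)
      then have "p dvd q" using pos by simp
      then show False using \<open>q \<noteq> p\<close> p(1) q(1) primes_dvd_imp_eq by blast
    qed
  qed
  then have "prime_factors n \<subseteq> {p}" by (auto simp: in_prime_factors_iff)
  then have "n = p ^ multiplicity p n"
    using prime_factorization_nat[OF n] 
    by (cases "prime_factors n = {}") (auto simp: subset_singleton_iff prime_factorization_empty_iff n)
  then show thesis using that p(1) pdvdb by blast
qed

text \<open>Passing to a proper multiple keeps Euler's totient only when an odd number is doubled. This is the
single case in which the sizes of two nested generator classes coincide.\<close>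
lemma totient_multiple_eq_imp:
  fixes m k :: nat
  assumes "totient (m * k) = totient m" "m > 0" "k > 0"
  shows "k = 1 \<or> k = 2 \<and> odd m"
proof -
  have "totient m * totient (gcd m k) = totient m * (totient k * gcd m k)"
    using totient_gcd[of m k] assms by (simp add: mult.assoc)
  then have eq: "totient (gcd m k) = totient k * gcd m k" using assms(2) by simp
  have g: "gcd m k > 0" using assms by simp
  have tk: "totient k = 1"
  proof (rule ccontr)
    assume "totient k \<noteq> 1"
    moreover have "totient k > 0" using assms(3) by simp
    ultimately have "totient k \<ge> 2" by linarith
    then have "2 * gcd m k \<le> totient (gcd m k)" using eq by simp
    then show False using totient_le[of "gcd m k"] g by linarith
  qed
  then have "k \<le> 2" using totient_gt_1[of k] by linarith
  moreover have "\<not> gcd m k > 1" using eq tk totient_less[of "gcd m k"] by force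
  ultimately have "k = 1 \<or> k = 2" "gcd m k = 1" using g assms(3) by linarith+
  then show ?thesis by auto
qed

lemma prime_power_divisors_comparable:
  fixes a b p :: nat
  assumes "prime p" "a dvd p ^ k" "b dvd p ^ k"
  shows "a dvd b \<or> b dvd a"
proof -
  obtain i where "a = p ^ i" using assms(2) divides_primepow_nat[OF assms(1)] by auto
  moreover obtain j where "b = p ^ j" using assms(3) divides_primepow_nat[OF assms(1)] by auto
  ultimately show ?thesis by (metis le_imp_power_dvd nat_le_linear)
qed

lemma prime_power_dvd_coprime_factor_iff:
  fixes p n m k :: nat
  assumes "prime p" "coprime n m" "p ^ k dvd n * m" "k > 0"
  shows "p ^ k dvd n \<longleftrightarrow> p dvd n"
proof
  assume "p ^ k dvd n" then show "p dvd n" using assms(4) dvd_power dvd_trans by blast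
next
  assume "p dvd n"
  then have "\<not> p dvd m" using assms(1,2) by (meson coprime_common_divisor not_prime_unit)
  then have "coprime (p ^ k) m" using assms(1) prime_imp_coprime by auto
  then show "p ^ k dvd n" using assms(3) by (simp add: coprime_dvd_mult_left_iff)
qed

section \<open>Cyclic subgroups of a finite group\<close>

locale finite_group = group +
  assumes fin [simp]: "finite (carrier G)"
begin

abbreviation cyc :: "'a \<Rightarrow> 'a set" where "cyc x \<equiv> generate G {x}"

lemma self_in_cyc [simp]: "x \<in> cyc x"
  by (simp add: generate.incl)

lemma cyc_closed: "x \<in> carrier G \<Longrightarrow> cyc x \<subseteq> carrier G"
  by (simp add: generate_incl)

lemma cyc_carrier: "y \<in> cyc x \<Longrightarrow> x \<in> carrier G \<Longrightarrow> y \<in> carrier G"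
  using cyc_closed by blast

lemma finite_cyc: "x \<in> carrier G \<Longrightarrow> finite (cyc x)"
  using cyc_closed fin finite_subset by blast

lemma ord_pos: "x \<in> carrier G \<Longrightarrow> ord x > 0"
  using ord_ge_1[OF fin] by fastforce

lemma cyc_pow: "x \<in> carrier G \<Longrightarrow> cyc x = range (\<lambda>k::nat. x [^] k)"
  using generate_pow_on_finite_carrier[OF fin] by (simp add: full_SetCompr_eq)

lemma cyc_mono: "y \<in> cyc x \<Longrightarrow> x \<in> carrier G \<Longrightarrow> cyc y \<subseteq> cyc x"
  by (simp add: generate_is_subgroup generate_subgroup_incl)

lemma cyc_trans: "z \<in> cyc y \<Longrightarrow> y \<in> cyc x \<Longrightarrow> x \<in> carrier G \<Longrightarrow> z \<in> cyc x"
  using cyc_mono by blast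

lemma one_in_cyc [simp]: "\<one> \<in> cyc x"
  by (simp add: generate.one)

lemma cyc_one [simp]: "cyc \<one> = {\<one>}"
  by (simp add: generate_one)

lemma card_cyc: "x \<in> carrier G \<Longrightarrow> card (cyc x) = ord x"
  by (simp add: generate_pow_card)

lemma ord_dvd_of_mem_cyc: "y \<in> cyc x \<Longrightarrow> x \<in> carrier G \<Longrightarrow> ord y dvd ord x"
  by (auto simp: cyc_pow pow_eq_id[symmetric] nat_pow_pow)
     (metis mult.commute nat_pow_one nat_pow_pow pow_ord_eq_1)

text \<open>A finite cyclic group has at most one subgroup of each order, so inside a cyclic group the inclusion
of cyclic subgroups is divisibility of orders.\<close>
lemma mem_cyc_iff_ord_dvd:
  assumes v: "v \<in> carrier G" and u: "u \<in> cyc v" and w: "w \<in> cyc v"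
  shows "u \<in> cyc w \<longleftrightarrow> ord u dvd ord w"
proof
  assume "u \<in> cyc w" then show "ord u dvd ord w" using ord_dvd_of_mem_cyc cyc_carrier v w by blast
next
  assume dvd: "ord u dvd ord w"
  obtain i j :: nat where ij: "u = v [^] i" "w = v [^] j" using u w cyc_pow[OF v] by auto
  have n: "ord v > 0" using ord_pos v by blast
  have "u [^] ord w = \<one>" using dvd cyc_carrier[OF u v] by (simp add: pow_eq_id)
  then have "ord v dvd i * ord w" using ij(1) v by (simp add: nat_pow_pow pow_eq_id)
  moreover have "ord w * gcd (ord v) j = ord v"
    using ij(2) ord_pow_gen[OF v, of j] by (cases "j = 0") auto
  ultimately have "ord w * gcd (ord v) j dvd ord w * i" by (simp add: mult.commute)
  moreover have "ord w > 0" using ord_pos w v cyc_carrier by blast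
  ultimately have "gcd (ord v) j dvd i" by simp
  then have "gcd (int j) (int (ord v)) dvd int i" by (simp add: gcd.commute gcd_int_int_eq)
  then obtain t where t: "int i = gcd (int j) (int (ord v)) * t" by blast
  \<comment> \<open>Bezout: modulo the order of \<open>v\<close>, the exponent \<open>i\<close> is a multiple of
    \<open>j\<close>.\<close>
  obtain a b where ab: "a * int j + b * int (ord v) = gcd (int j) (int (ord v))"
    using bezout_int by blast
  have "int (ord v) dvd int i - int j * (a * t)"
  proof -
    have "int i - int j * (a * t) = int (ord v) * (b * t)" unfolding t ab[symmetric] by (simp add: algebra_simps)
    then show ?thesis by simp
  qed
  then have "v [^] (int j * (a * t)) = v [^] int i" using int_pow_eq[OF v] by blast
  then have "u = w [^] (a * t)"
    using ij v by (simp add: int_pow_pow int_pow_int flip: int_pow_int)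
  moreover have "w \<in> carrier G" using w v cyc_carrier by blast
  ultimately show "u \<in> cyc w" using generate_pow by blast
qed

lemma exists_ord_in_cyc:
  assumes v: "v \<in> carrier G" and d: "d dvd ord v"
  obtains w where "w \<in> cyc v" "ord w = d"
proof -
  obtain e where e: "ord v = d * e" using d by blast
  then have "e \<noteq> 0" "d > 0" using ord_pos[OF v] by auto
  then have "ord (v [^] e) = d" using ord_pow[OF v, of e] e by simp
  moreover have "v [^] e \<in> cyc v" using cyc_pow[OF v] by auto
  ultimately show thesis using that by blast
qed

definition gens :: "'a \<Rightarrow> 'a set" where
  "gens x = {z \<in> cyc x. ord z = ord x}"

lemma card_gens:
  assumes x: "x \<in> carrier G"
  shows "card (gens x) = totient (ord x)"
proof -
  have "gens x = (\<lambda>k. x [^] k) ` totatives (ord x)"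
  proof (intro equalityI subsetI)
    fix z assume z: "z \<in> gens x"
    then obtain k :: nat where k: "z = x [^] k" using cyc_pow[OF x] by (auto simp: gens_def)
    have cop: "coprime k (ord x)" using z k pow_ord_eq_ord_iff[OF fin x] by (auto simp: gens_def)
    show "z \<in> (\<lambda>k. x [^] k) ` totatives (ord x)"
    proof (cases "ord x = 1")
      case True
      then have "x = \<one>" using x ord_eq_1 by blast
      then show ?thesis using k by simp
    next
      case False
      then have o: "ord x > 1" using ord_pos[OF x] by linarith
      have "k mod ord x \<noteq> 0" using cop o by (metis coprime_iff_gcd_eq_1 gcd_0_nat gcd_red_nat gcd.commute less_numeral_extra(4))
      moreover have "k mod ord x < ord x" using o by simp
      moreover have "coprime (k mod ord x) (ord x)" using cop o by simp
      ultimately have "k mod ord x \<in> totatives (ord x)" by (simp add: in_totatives_iff)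
      moreover have "x [^] (k mod ord x) = z"
      proof -
        have "x [^] k = x [^] (ord x * (k div ord x) + k mod ord x)" by simp
        also have "\<dots> = (x [^] ord x) [^] (k div ord x) \<otimes> x [^] (k mod ord x)"
          using x by (metis nat_pow_mult nat_pow_pow)
        finally show ?thesis using x k by (simp del: mult_div_mod_eq)
      qed
      ultimately show ?thesis by blast
    qed
  next
    fix z assume "z \<in> (\<lambda>k. x [^] k) ` totatives (ord x)"
    then obtain k where k: "coprime k (ord x)" "z = x [^] k" by (auto simp: in_totatives_iff)
    then show "z \<in> gens x" using pow_ord_eq_ord_iff[OF fin x] cyc_pow[OF x] by (auto simp: gens_def)
  qed
  moreover have "inj_on (\<lambda>k. x [^] k) (totatives (ord x))"
    by (rule inj_on_subset[OF ord_inj'[OF x]]) (auto simp: in_totatives_iff)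
  ultimately show ?thesis by (simp add: card_image totient_def)
qed

lemma gens_iff: "x \<in> carrier G \<Longrightarrow> z \<in> gens x \<longleftrightarrow> z \<in> cyc x \<and> x \<in> cyc z"
  unfolding gens_def using mem_cyc_iff_ord_dvd[of x] ord_dvd_of_mem_cyc[of z x]
  by (auto intro: dvd_antisym)

lemma cauchy:
  assumes "prime p" "p dvd order G"
  obtains u where "u \<in> carrier G" "ord u = p"
proof -
  \<comment> \<open>A subgroup of order \<open>p\<close> consists of the identity and elements of order
    \<open>p\<close>.\<close>
  obtain m where "order G = p ^ 1 * m" using assms(2) by auto
  then obtain H where H: "subgroup H G" "card H = p ^ 1"
    using sylow_thm[OF assms(1) is_group] fin by blast
  then have "card H > 1" using assms(1) prime_gt_1_nat by simp
  then have "\<not> H \<subseteq> {\<one>}" using card_mono[of "{\<one>}" H] by auto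
  then obtain u where u: "u \<in> H" "u \<noteq> \<one>" by blast
  have uG: "u \<in> carrier G" using u H subgroup.mem_carrier by metis
  have "cyc u \<subseteq> H" using u H by (simp add: generate_subgroup_incl)
  interpret HG: group "G\<lparr>carrier := H\<rparr>" using H subgroup_imp_group by blast
  have "ord u dvd p"
  proof -
    have "u [^]\<^bsub>G\<lparr>carrier := H\<rparr>\<^esub> order (G\<lparr>carrier := H\<rparr>) = \<one>"
      using HG.pow_order_eq_1[of u] u by simp
    moreover have "order (G\<lparr>carrier := H\<rparr>) = p" using H by (simp add: order_def)
    ultimately have "u [^] p = \<one>" using nat_pow_consistent by metis
    then show ?thesis using uG pow_eq_id by blast
  qed
  then have "ord u = p" using assms(1) u uG ord_eq_1 by (metis prime_nat_iff)
  then show thesis using that uG by blast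
qed

end

section \<open>Isomorphism invariants of a graph\<close>

text \<open>Here \<open>c\<close> is reflexive adjacency: equal or joined by an edge. Two vertices are twins if
they have the same closed neighbourhood.\<close>
definition twins :: "'a set \<Rightarrow> ('a \<Rightarrow> 'a \<Rightarrow> bool) \<Rightarrow> 'a \<Rightarrow> 'a set" where
  "twins V c x = {z \<in> V. \<forall>w\<in>V. c z w \<longleftrightarrow> c x w}"

definition dominating :: "'a set \<Rightarrow> ('a \<Rightarrow> 'a \<Rightarrow> bool) \<Rightarrow> 'a set" where
  "dominating V c = {x \<in> V. \<forall>w\<in>V. c x w}"

text \<open>For adjacent non-twins \<open>y\<close> and \<open>x\<close> outside the dominating set of a power
graph, this recovers from the graph alone whether \<open>y\<close> is a power of \<open>x\<close>: the vertex
with the larger twin class lies above. Such neighbours have twin classes of equal size only if their orders are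
\<open>k\<close> and \<open>2 * k\<close> with \<open>k\<close> odd; the vertex of even order is then the one
that has an involution, a non-dominating vertex without other twins, as a neighbour.\<close>
definition graph_below :: "'a set \<Rightarrow> ('a \<Rightarrow> 'a \<Rightarrow> bool) \<Rightarrow> 'a \<Rightarrow> 'a \<Rightarrow> bool" where
  "graph_below V c y x \<longleftrightarrow>
     card (twins V c y) < card (twins V c x) \<or>
     card (twins V c y) = card (twins V c x) \<and>
       (\<exists>u \<in> V - dominating V c. card (twins V c u) = 1 \<and> c u x)"

text \<open>In the power graph of a group whose order is not a prime power, this is the largest order of a twin
of the non-dominating vertex \<open>x\<close>: the cyclic group generated by such a twin \<open>y\<close>
consists of the identity (the summand \<open>1\<close>), the twins, and the other elements strictly below
\<open>x\<close>.\<close>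
definition graph_ord :: "'a set \<Rightarrow> ('a \<Rightarrow> 'a \<Rightarrow> bool) \<Rightarrow> 'a \<Rightarrow> nat" where
  "graph_ord V c x = 1 + card (twins V c x) +
     card {z \<in> V - dominating V c - twins V c x. c z x \<and> graph_below V c z x}"

context
  fixes f V c V' c'
  assumes bij: "bij_betw f V V'"
    and iso: "\<And>x y. x \<in> V \<Longrightarrow> y \<in> V \<Longrightarrow> c' (f x) (f y) \<longleftrightarrow> c x y"
begin

lemma graph_iso_ball: "(\<forall>w\<in>V'. P w) \<longleftrightarrow> (\<forall>w\<in>V. P (f w))"
  using bij by (auto simp: bij_betw_def)

lemma graph_iso_bex: "(\<exists>w\<in>V'. P w) \<longleftrightarrow> (\<exists>w\<in>V. P (f w))"
  using bij by (auto simp: bij_betw_def)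

lemma graph_iso_Collect: "{w\<in>V'. P w} = f ` {w\<in>V. P (f w)}"
  using bij by (auto simp: bij_betw_def)

lemma graph_iso_card: "card {w\<in>V'. P w} = card {w\<in>V. P (f w)}"
  unfolding graph_iso_Collect
  by (rule card_image, rule inj_on_subset[OF bij_betw_imp_inj_on[OF bij]]) auto

lemma graph_iso_mem: "x \<in> V \<Longrightarrow> f x \<in> V'"
  using bij by (auto simp: bij_betw_def)

lemma graph_iso_twins: "x \<in> V \<Longrightarrow> z \<in> V \<Longrightarrow> f z \<in> twins V' c' (f x) \<longleftrightarrow> z \<in> twins V c x"
  by (simp add: twins_def graph_iso_ball iso graph_iso_mem)

lemma graph_iso_card_twins: "x \<in> V \<Longrightarrow> card (twins V' c' (f x)) = card (twins V c x)"
  unfolding twins_def by (simp add: graph_iso_card graph_iso_ball iso cong: conj_cong)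

lemma graph_iso_dominating: "x \<in> V \<Longrightarrow> f x \<in> dominating V' c' \<longleftrightarrow> x \<in> dominating V c"
  by (simp add: dominating_def graph_iso_ball iso graph_iso_mem)

lemma graph_iso_graph_below:
  assumes "x \<in> V" "y \<in> V"
  shows "graph_below V' c' (f y) (f x) \<longleftrightarrow> graph_below V c y x"
proof -
  have "(\<exists>u \<in> V' - dominating V' c'. card (twins V' c' u) = 1 \<and> c' u (f x)) \<longleftrightarrow>
        (\<exists>u \<in> V'. u \<notin> dominating V' c' \<and> card (twins V' c' u) = 1 \<and> c' u (f x))" by blast
  also have "\<dots> \<longleftrightarrow> (\<exists>u \<in> V. u \<notin> dominating V c \<and> card (twins V c u) = 1 \<and> c u x)"
    using assms by (simp add: graph_iso_bex graph_iso_dominating graph_iso_card_twins iso cong: conj_cong bex_cong)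
  finally show ?thesis using assms by (auto simp: graph_below_def graph_iso_card_twins)
qed

lemma graph_iso_graph_ord:
  assumes "x \<in> V"
  shows "graph_ord V' c' (f x) = graph_ord V c x"
proof -
  have "{z \<in> V' - dominating V' c' - twins V' c' (f x). c' z (f x) \<and> graph_below V' c' z (f x)}
      = {z \<in> V'. z \<notin> dominating V' c' \<and> z \<notin> twins V' c' (f x) \<and> c' z (f x) \<and> graph_below V' c' z (f x)}"
    by blast
  moreover have "card \<dots> = card {z \<in> V. z \<notin> dominating V c \<and> z \<notin> twins V c x \<and> c z x \<and> graph_below V c z x}"
    using assms by (simp add: graph_iso_card graph_iso_dominating graph_iso_twins graph_iso_graph_below iso cong: conj_cong)
  moreover have "{z \<in> V - dominating V c - twins V c x. c z x \<and> graph_below V c z x}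
      = {z \<in> V. z \<notin> dominating V c \<and> z \<notin> twins V c x \<and> c z x \<and> graph_below V c z x}" by blast
  ultimately show ?thesis using assms by (simp add: graph_ord_def graph_iso_card_twins)
qed

end

section \<open>Element orders in the power graph\<close>

context finite_group
begin

text \<open>Adjacency or equality in the power graph.\<close>
definition comparable :: "'a \<Rightarrow> 'a \<Rightarrow> bool" where
  "comparable x y \<longleftrightarrow> x \<in> cyc y \<or> y \<in> cyc x"

abbreviation "K \<equiv> twins (carrier G) comparable"
abbreviation "S \<equiv> dominating (carrier G) comparable"

lemma comparable_refl [simp]: "comparable x x"
  by (simp add: comparable_def)

lemma comparable_sym: "comparable x y \<longleftrightarrow> comparable y x"
  by (auto simp: comparable_def)

lemma one_in_S: "\<one> \<in> S"
  by (simp add: dominating_def comparable_def)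

lemma K_carrier: "z \<in> K x \<Longrightarrow> z \<in> carrier G"
  by (simp add: twins_def)

lemma finite_K [simp]: "finite (K x)"
  by (rule finite_subset[OF _ fin]) (auto simp: twins_def)

lemma K_refl: "x \<in> carrier G \<Longrightarrow> x \<in> K x"
  by (simp add: twins_def)

lemma K_comparable: "z \<in> K x \<Longrightarrow> w \<in> carrier G \<Longrightarrow> comparable z w \<longleftrightarrow> comparable x w"
  by (simp add: twins_def)

lemma K_eq: "z \<in> K x \<Longrightarrow> K z = K x"
  by (auto simp: twins_def)

lemma K_sym: "z \<in> K x \<Longrightarrow> x \<in> carrier G \<Longrightarrow> x \<in> K z"
  by (auto simp: twins_def)

lemma K_nbr: "z \<in> K x \<Longrightarrow> x \<in> carrier G \<Longrightarrow> comparable z x"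
  by (simp add: twins_def)

lemma K_S: "z \<in> K x \<Longrightarrow> x \<in> carrier G \<Longrightarrow> z \<in> S \<longleftrightarrow> x \<in> S"
  by (auto simp: twins_def dominating_def)

lemma S_carrier: "z \<in> S \<Longrightarrow> z \<in> carrier G"
  by (simp add: dominating_def)

lemma gens_subset_K:
  assumes x: "x \<in> carrier G"
  shows "gens x \<subseteq> K x"
proof
  fix z assume "z \<in> gens x"
  then have z: "z \<in> cyc x" "x \<in> cyc z" using gens_iff x by blast+
  then have zG: "z \<in> carrier G" using cyc_carrier x by blast
  have "cyc z = cyc x" using z cyc_mono x zG by blast
  moreover have "z \<in> cyc w \<longleftrightarrow> x \<in> cyc w" if "w \<in> carrier G" for w
    using z cyc_trans that by blast
  ultimately show "z \<in> K x" using zG by (simp add: twins_def comparable_def)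
qed

lemma totient_le_card_K: "x \<in> carrier G \<Longrightarrow> totient (ord x) \<le> card (K x)"
  by (metis card_gens card_mono finite_K gens_subset_K)

lemma comparable_in_cyc_iff:
  assumes "v \<in> carrier G" "u \<in> cyc v" "w \<in> cyc v"
  shows "comparable u w \<longleftrightarrow> ord u dvd ord w \<or> ord w dvd ord u"
  using mem_cyc_iff_ord_dvd assms by (auto simp: comparable_def)

text \<open>Inside the cyclic group generated by \<open>v\<close> comparability is divisibility of orders, so
two distinct levels of it, other than the identity, with the same comparable elements force the order of
\<open>v\<close> to be a prime power.\<close>
lemma prime_power_ord_of_comparability:
  assumes v: "v \<in> carrier G" and hi: "hi \<in> cyc v" and lo: "lo \<in> cyc hi" "lo \<noteq> \<one>" "ord lo \<noteq> ord hi"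
    and agree: "\<And>w. w \<in> cyc v \<Longrightarrow> comparable lo w \<longleftrightarrow> comparable hi w"
  obtains p k where "prime p" "ord v = p ^ k" "p dvd ord lo"
proof (rule prime_power_if_comparable_divisors_agree[of "ord v" "ord lo" "ord hi"])
  have hiG: "hi \<in> carrier G" using v hi cyc_carrier by blast
  have loG: "lo \<in> carrier G" using hiG lo cyc_carrier by blast
  have lov: "lo \<in> cyc v" using lo hi v cyc_trans by blast
  show "ord v > 0" using v ord_pos by blast
  show "ord lo dvd ord hi" "ord hi dvd ord v" using ord_dvd_of_mem_cyc lo hi v hiG by blast+
  show "ord lo \<noteq> ord hi" by fact
  show "ord lo \<noteq> 1" using lo loG ord_eq_1 by blast
  fix d assume "d dvd ord v"
  then obtain w where "w \<in> cyc v" "ord w = d" using exists_ord_in_cyc v by metis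
  then show "d dvd ord lo \<or> ord lo dvd d \<longleftrightarrow> d dvd ord hi \<or> ord hi dvd d"
    using agree[of w] comparable_in_cyc_iff[OF v, of _ w] lov hi by blast
qed (use that in blast)

text \<open>The twins of \<open>x\<close> always include the generators of its cyclic subgroup. As soon as there
is another twin, two twins lie on distinct levels \<open>lo\<close> and \<open>hi\<close> of a cyclic group;
neither is the identity, because \<open>x\<close> is not dominating. So the preceding lemma applies to every
cyclic group through \<open>hi\<close>. So all neighbours of \<open>x\<close> have order a power of one
prime.\<close>
lemma prime_power_nbrs:
  assumes x: "x \<in> carrier G" "x \<notin> S" and ne: "K x \<noteq> gens x"
  obtains p where "prime p" "\<And>v. v \<in> carrier G \<Longrightarrow> comparable v x \<Longrightarrow> \<exists>k. ord v = p ^ k"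
proof -
  obtain z where z: "z \<in> K x" "z \<notin> gens x" using ne gens_subset_K[OF x(1)] by blast
  have zG: "z \<in> carrier G" using z K_carrier by blast
  have "comparable z x" using z x K_nbr by blast
  moreover have "\<not> (z \<in> cyc x \<and> x \<in> cyc z)" using z(2) gens_iff x by blast
  ultimately consider "z \<in> cyc x" "x \<notin> cyc z" | "x \<in> cyc z" "z \<notin> cyc x"
    unfolding comparable_def by blast
  then obtain lo hi where lh: "lo \<in> K x" "hi \<in> K x" "lo \<in> cyc hi" "hi \<notin> cyc lo"
    using z(1) K_refl[OF x(1)] by cases (use that in blast)+
  have G: "lo \<in> carrier G" "hi \<in> carrier G" using lh K_carrier by blast+
  have lo1: "lo \<noteq> \<one>" using lh(1) x K_S one_in_S by blast
  have one: "ord lo \<noteq> ord hi" using lh(3,4) G mem_cyc_iff_ord_dvd[of hi hi lo] by auto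
  have agree: "comparable lo w \<longleftrightarrow> comparable hi w" if "w \<in> carrier G" for w
    using K_comparable lh that by blast
  obtain p a where p: "prime p" "ord hi = p ^ a" "p dvd ord lo"
    using prime_power_ord_of_comparability[OF G(2) self_in_cyc lh(3) lo1 one] agree cyc_carrier G by metis
  have "\<exists>k. ord v = p ^ k" if v: "v \<in> carrier G" "comparable v x" for v
  proof -
    have "comparable hi v" using v K_comparable lh(2) comparable_sym by blast
    then show ?thesis unfolding comparable_def
    proof
      assume hv: "hi \<in> cyc v"
      obtain q k where q: "prime q" "ord v = q ^ k" 
        using prime_power_ord_of_comparability[OF v(1) hv lh(3) lo1 one] agree cyc_carrier v by metis
      have "p dvd q ^ k" 
        using p(3) ord_dvd_of_mem_cyc[OF lh(3) G(2)] ord_dvd_of_mem_cyc[OF hv v(1)] q(2) dvd_trans by metis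
      then have "p = q" using p(1) q(1) prime_dvd_power primes_dvd_imp_eq by blast
      then show ?thesis using q by blast
    next
      assume "v \<in> cyc hi"
      then have "ord v dvd p ^ a" using ord_dvd_of_mem_cyc G p by metis
      then show ?thesis using divides_primepow_nat[OF p(1)] by auto
    qed
  qed
  then show thesis using that p(1) by blast
qed

text \<open>Twin classes are convex for the power relation. The case that needs an argument is a class with more
than one level, and there the elements below \<open>y\<close> form a chain.\<close>
lemma K_convex:
  assumes y: "y \<in> carrier G" "y \<notin> S" and xz: "x \<in> cyc z" "z \<in> cyc y" and xy: "x \<in> K y"
  shows "z \<in> K y"
proof (cases "K y = gens y")
  case True
  then have "y \<in> cyc x" using xy gens_iff y by blast
  then have "y \<in> cyc z" using xz y cyc_trans cyc_carrier by blast
  then have "z \<in> gens y" using xz y gens_iff by blast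
  then show ?thesis using True by blast
next
  case False
  obtain p where p: "prime p" "\<And>v. v \<in> carrier G \<Longrightarrow> comparable v y \<Longrightarrow> \<exists>k. ord v = p ^ k"
    using prime_power_nbrs[OF y False] by blast
  obtain k where k: "ord y = p ^ k" using p(2)[of y] y by auto
  have zG: "z \<in> carrier G" using xz y cyc_carrier by blast
  have chain: "comparable u w" if "u \<in> cyc y" "w \<in> cyc y" for u w
  proof -
    have "ord u dvd p ^ k" "ord w dvd p ^ k" using that k ord_dvd_of_mem_cyc[OF _ y(1)] by auto
    then show ?thesis
      using comparable_in_cyc_iff[OF y(1) that] prime_power_divisors_comparable[OF p(1)] by blast
  qed
  have "comparable z w \<longleftrightarrow> comparable y w" if w: "w \<in> carrier G" for w
  proof
    assume zw: "comparable z w"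
    have "comparable x w"
    proof (cases "z \<in> cyc w")
      case True then show ?thesis using xz w cyc_trans by (auto simp: comparable_def)
    next
      case False
      then have "w \<in> cyc z" using zw by (auto simp: comparable_def)
      then show ?thesis using chain cyc_trans xz zG y by blast
    qed
    then show "comparable y w" using xy w K_comparable by blast
  next
    assume "comparable y w"
    then consider "y \<in> cyc w" | "w \<in> cyc y" unfolding comparable_def by blast
    then show "comparable z w"
    proof cases
      case 1 then show ?thesis using xz(2) w cyc_trans by (auto simp: comparable_def)
    next
      case 2 then show ?thesis using xz(2) chain by blast
    qed
  qed
  then show ?thesis using zG by (simp add: twins_def)
qed

text \<open>In a class with more than one level, all twins of \<open>y\<close> lie strictly below
\<open>v\<close>, by convexity, and they differ from the identity. Since \<open>v\<close> has order \<open>p ^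
k\<close>, there are fewer than \<open>p ^ (k - 1)\<close> such elements, while \<open>v\<close> has at least
\<open>p ^ (k - 1)\<close> generators.\<close>
lemma card_K_less:
  assumes y: "y \<in> carrier G" "y \<notin> S" and v: "v \<in> carrier G" "y \<in> cyc v" "v \<notin> K y"
    and ne: "K y \<noteq> gens y"
  shows "card (K y) < totient (ord v)"
proof -
  obtain p where p: "prime p" "\<And>v. v \<in> carrier G \<Longrightarrow> comparable v y \<Longrightarrow> \<exists>k. ord v = p ^ k"
    using prime_power_nbrs[OF y ne] by blast
  obtain k where k: "ord v = p ^ k" using p(2)[of v] v by (auto simp: comparable_def)
  have "K y \<subseteq> cyc v - gens v - {\<one>}"
  proof
    fix z assume z: "z \<in> K y"
    then have zG: "z \<in> carrier G" using K_carrier by blast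
    have "v \<notin> cyc z"
    proof
      assume "v \<in> cyc z"
      moreover have "y \<in> K z" "z \<notin> S" using z y K_sym K_S by blast+
      ultimately have "v \<in> K z" using K_convex[of z y v] zG v by blast
      then show False using v(3) K_eq[OF z] by simp
    qed
    moreover have "comparable z v"
      using z v K_comparable unfolding comparable_def by blast
    moreover have "z \<noteq> \<one>" using z y K_S one_in_S by blast
    ultimately show "z \<in> cyc v - gens v - {\<one>}" using gens_iff v(1) by (auto simp: comparable_def)
  qed
  then have "card (K y) \<le> card (cyc v - gens v - {\<one>})"
    using finite_cyc[OF v(1)] by (intro card_mono) auto
  also have "\<dots> = p ^ k - totient (p ^ k) - 1"
  proof -
    have "v \<noteq> \<one>" using v y K_refl by auto
    then have "\<one> \<notin> gens v" using ord_eq_1[OF v(1)] ord_id by (auto simp: gens_def)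
    moreover have "gens v \<subseteq> cyc v" by (auto simp: gens_def)
    ultimately show ?thesis using finite_cyc[OF v(1)] card_cyc card_gens v(1) k
      by (subst card_Diff_subset card_Diff_singleton; auto intro: finite_subset)+
  qed
  also have "\<dots> < totient (p ^ k)"
  proof -
    have "k > 0" using v(3) y k v ord_eq_1 K_refl by (metis cyc_one gr0I power_0 singletonD)
    then obtain l where l: "k = Suc l" using gr0_implies_Suc by blast
    have t: "totient (p ^ k) = p ^ l * (p - 1)" using l totient_prime_power_Suc[OF p(1)] by simp
    have "p \<ge> 2" using p(1) prime_ge_2_nat by blast
    then obtain r where r: "p = Suc (Suc r)" by (metis add_2_eq_Suc le_Suc_ex)
    have "p ^ k = p ^ l * (p - 1) + p ^ l" using l r by (simp add: algebra_simps)
    moreover have "p ^ l \<le> p ^ l * (p - 1)" using r by simp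
    moreover have "p ^ l > 0" using r by simp
    ultimately show ?thesis unfolding t by linarith
  qed
  finally show ?thesis using k by simp
qed

lemma card_K_strict_or_tie:
  assumes y: "y \<in> carrier G" "y \<notin> S" and v: "v \<in> carrier G" "y \<in> cyc v" "v \<notin> K y"
  shows "card (K y) < card (K v) \<or>
    card (K y) = card (K v) \<and> K y = gens y \<and> K v = gens v \<and> totient (ord y) = totient (ord v)"
proof (cases "K y = gens y")
  case False
  then show ?thesis using card_K_less[OF y v] totient_le_card_K[OF v(1)] by linarith
next
  case True
  have "totient (ord y) \<le> totient (ord v)"
    using ord_dvd_of_mem_cyc v ord_pos by (intro totient_dvd_mono) auto
  moreover have "K v = gens v" if "card (K v) = totient (ord v)"
    using that card_gens v gens_subset_K finite_K by (metis card_subset_eq)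
  ultimately show ?thesis using True card_gens y totient_le_card_K[OF v(1)] 
    by (metis le_neq_implies_less le_trans order_antisym_conv)
qed

text \<open>In a tie the order of \<open>v\<close> is twice the odd order of \<open>y\<close>. The involution
\<open>u\<close> in the cyclic group of \<open>v\<close> has no other twin: otherwise its neighbour
\<open>v\<close> would have order a power of two. Conversely, a non-dominating vertex without other twins has
order two, and an involution is not adjacent to an element of odd order greater than one.\<close>
lemma tie_witness:
  assumes y: "y \<in> carrier G" "y \<notin> S" and v: "v \<in> carrier G" "y \<in> cyc v" "v \<notin> K y" "v \<notin> S"
    and tie: "K y = gens y" "K v = gens v" "totient (ord y) = totient (ord v)"
  shows "\<exists>u \<in> carrier G - S. card (K u) = 1 \<and> comparable u v"
    and "\<not> (\<exists>u \<in> carrier G - S. card (K u) = 1 \<and> comparable u y)"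
proof -
  obtain k where k: "ord v = ord y * k" using ord_dvd_of_mem_cyc v by blast
  have pos: "ord y > 0" "k > 0" using ord_pos[OF y(1)] ord_pos[OF v(1)] k by auto
  have "k \<noteq> 1"
  proof
    assume "k = 1"
    then have "v \<in> cyc y" using k v mem_cyc_iff_ord_dvd[of v v y] by simp
    then show False using gens_iff v y tie(1) by blast
  qed
  then have kk: "k = 2" "odd (ord y)" using totient_multiple_eq_imp[of "ord y" k] k tie(3) pos by auto
  have y1: "ord y \<noteq> 1" using y ord_eq_1 one_in_S by blast
  obtain u where u: "u \<in> cyc v" "ord u = 2" using exists_ord_in_cyc[OF v(1), of 2] k kk by auto
  have uG: "u \<in> carrier G" using u v cyc_carrier by blast
  have uS: "u \<notin> S"
  proof
    assume "u \<in> S"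
    then have "comparable u y" using y by (auto simp: dominating_def)
    then have "2 dvd ord y \<or> ord y dvd 2" using u(2) ord_dvd_of_mem_cyc y uG unfolding comparable_def by metis
    then show False using kk y1 by (auto dest: prime_nat_iff[THEN iffD1, OF two_is_prime_nat, THEN conjunct2, rule_format])
  qed
  have "K u = gens u"
  proof (rule ccontr)
    assume "K u \<noteq> gens u"
    then obtain p where p: "prime p" "\<And>v. v \<in> carrier G \<Longrightarrow> comparable v u \<Longrightarrow> \<exists>k. ord v = p ^ k"
      using prime_power_nbrs[OF uG uS] by blast
    obtain i where "ord v = p ^ i" using p(2)[of v] v u by (auto simp: comparable_def)
    then have i: "ord y * 2 = p ^ i" using k kk by simp
    then have "2 dvd p ^ i" by (metis dvd_triv_right)
    then have "p = 2" using p(1) by (metis prime_dvd_power primes_dvd_imp_eq two_is_prime_nat)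
    moreover have "ord y dvd p ^ i" using i by (metis dvd_triv_left)
    ultimately obtain j where "ord y = 2 ^ j" using divides_primepow_nat[of 2 "ord y" i] by auto
    then show False using kk(2) y1 by (cases j) auto
  qed
  then have "card (K u) = 1" using card_gens uG u by simp
  then show "\<exists>u \<in> carrier G - S. card (K u) = 1 \<and> comparable u v"
    using u uG uS by (auto simp: comparable_def)
  show "\<not> (\<exists>u \<in> carrier G - S. card (K u) = 1 \<and> comparable u y)"
  proof
    assume "\<exists>u \<in> carrier G - S. card (K u) = 1 \<and> comparable u y"
    then obtain u where u: "u \<in> carrier G" "u \<notin> S" "card (K u) = 1" "comparable u y" by blast
    then have "totient (ord u) \<le> 1" using totient_le_card_K by metis
    then have "ord u \<le> 2" using totient_gt_1[of "ord u"] by linarith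
    moreover have "ord u \<noteq> 1" using u one_in_S ord_eq_1 by blast
    ultimately have "ord u = 2" using ord_pos u by (metis One_nat_def Suc_1 le_SucE le_antisym less_eq_Suc_le)
    then have "2 dvd ord y \<or> ord y dvd 2" using u(4,1) ord_dvd_of_mem_cyc y unfolding comparable_def by metis
    then show False using kk y1 by (auto dest: prime_nat_iff[THEN iffD1, OF two_is_prime_nat, THEN conjunct2, rule_format])
  qed
qed

lemma graph_below_iff:
  assumes y: "y \<in> carrier G" "y \<notin> S" and v: "v \<in> carrier G" "v \<notin> S"
    and cmp: "comparable y v" and ne: "v \<notin> K y"
  shows "graph_below (carrier G) comparable y v \<longleftrightarrow> y \<in> cyc v"
proof (cases "y \<in> cyc v")
  case True
  then show ?thesis
    using card_K_strict_or_tie[OF y v(1) True ne] tie_witness(1)[OF y v(1) True ne v(2)]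
    unfolding graph_below_def by blast
next
  case False
  then have vy: "v \<in> cyc y" using cmp by (auto simp: comparable_def)
  have ne': "y \<notin> K v" using ne K_sym v by blast
  have "card (K v) < card (K y) \<or>
      card (K v) = card (K y) \<and> \<not> (\<exists>u \<in> carrier G - S. card (K u) = 1 \<and> comparable u v)"
    using card_K_strict_or_tie[OF v y(1) vy ne'] tie_witness(2)[OF v y(1) vy ne' y(2)] by blast
  then have "\<not> graph_below (carrier G) comparable y v"
    unfolding graph_below_def by linarith
  then show ?thesis using False by blast
qed

text \<open>A dominating vertex is adjacent to an element of each prime order, which exists by Cauchy's
theorem.\<close>
lemma S_ord_dvd:
  assumes s: "s \<in> S" "s \<noteq> \<one>" and q: "prime q" "q dvd order G"
  shows "q dvd ord s"
proof -
  obtain u where u: "u \<in> carrier G" "ord u = q" using cauchy q by blast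
  have sG: "s \<in> carrier G" using s S_carrier by blast
  have "comparable s u" using s u by (simp add: dominating_def)
  then have "ord s dvd q \<or> q dvd ord s"
    using ord_dvd_of_mem_cyc u sG unfolding comparable_def by metis
  moreover have "ord s \<noteq> 1" using s sG ord_eq_1 by blast
  ultimately show ?thesis using q(1) by (metis dvd_refl prime_nat_iff)
qed

text \<open>A dominating non-identity power \<open>s\<close> of \<open>y\<close> is comparable with everything
below \<open>y\<close>, so the order of \<open>y\<close> would be a prime power; but every prime divisor of the
group order divides the order of \<open>s\<close>.\<close>
lemma cyc_disjoint_S:
  assumes pq: "prime p" "prime q" "p \<noteq> q" "p dvd order G" "q dvd order G"
    and y: "y \<in> carrier G" "y \<notin> S" and s: "s \<in> S" "s \<in> cyc y"
  shows "s = \<one>"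
proof (rule ccontr)
  assume s1: "s \<noteq> \<one>"
  have sG: "s \<in> carrier G" using s S_carrier by blast
  have "ord s \<noteq> ord y"
  proof
    assume "ord s = ord y"
    then have "s \<in> gens y" using s by (simp add: gens_def)
    then have "s \<in> K y" using gens_subset_K y by blast
    then show False using s y K_S by blast
  qed
  moreover have "comparable s w \<longleftrightarrow> comparable y w" if "w \<in> cyc y" for w
    using that s cyc_carrier y by (auto simp: dominating_def comparable_def)
  ultimately obtain r k where r: "prime r" "ord y = r ^ k"
    using prime_power_ord_of_comparability[OF y(1) self_in_cyc s(2) s1] by metis
  have "p dvd r ^ k" "q dvd r ^ k"
    using S_ord_dvd[OF s(1) s1] pq ord_dvd_of_mem_cyc[OF s(2) y(1)] r(2) dvd_trans by metis+
  then show False using pq r(1) by (metis prime_dvd_power primes_dvd_imp_eq)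
qed

lemma graph_ord_eq:
  assumes pq: "prime p" "prime q" "p \<noteq> q" "p dvd order G" "q dvd order G"
    and x: "x \<in> carrier G" "x \<notin> S"
  obtains y where "y \<in> K x" "graph_ord (carrier G) comparable x = ord y"
proof -
  obtain y where y: "y \<in> K x" and ymax: "\<And>z. z \<in> K x \<Longrightarrow> ord z \<le> ord y"
  proof -
    have "finite (ord ` K x)" "ord ` K x \<noteq> {}" using K_refl x by auto
    then have "Max (ord ` K x) \<in> ord ` K x" using Max_in by blast
    then obtain y where "y \<in> K x" "Max (ord ` K x) = ord y" by blast
    then show thesis using that[of y] Max_ge[of "ord ` K x"] by simp
  qed
  have yG: "y \<in> carrier G" using y K_carrier by blast
  have yS: "y \<notin> S" using y x K_S by blast
  have Kx: "K x = K y" using y K_eq by blast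
  \<comment> \<open>By maximality of its order, \<open>y\<close> lies on the top level of its twin
    class.\<close>
  have below: "z \<in> cyc y" if z: "z \<in> K x" for z
  proof (rule ccontr)
    assume "z \<notin> cyc y"
    moreover have zG: "z \<in> carrier G" using z K_carrier by blast
    moreover have "comparable z y" using K_nbr[of z y] z Kx yG by simp
    ultimately have yz: "y \<in> cyc z" by (auto simp: comparable_def)
    then have "ord y dvd ord z" using ord_dvd_of_mem_cyc zG by blast
    then have "ord z = ord y" using ymax[OF z] ord_pos[OF zG] by (simp add: dvd_imp_le le_antisym)
    then have "z \<in> cyc y" using mem_cyc_iff_ord_dvd[OF zG self_in_cyc yz] by simp
    then show False using \<open>z \<notin> cyc y\<close> by blast
  qed
  have disj: "s = \<one>" if "s \<in> S" "s \<in> cyc y" for s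
    using cyc_disjoint_S[OF pq yG yS] that by blast
  let ?B = "{z \<in> carrier G - S - K x. comparable z x \<and> graph_below (carrier G) comparable z x}"
  have B: "?B = cyc y - {\<one>} - K x"
  proof (intro equalityI subsetI)
    fix z assume "z \<in> ?B"
    then have z: "z \<in> carrier G" "z \<notin> S" "z \<notin> K x" "comparable z x" "graph_below (carrier G) comparable z x"
      by auto
    have "x \<notin> K z" using z K_sym by blast
    then have "z \<in> cyc x" using graph_below_iff[OF z(1,2) x z(4)] z(5) by blast
    then have "z \<in> cyc y" using below K_refl x cyc_trans yG by blast
    then show "z \<in> cyc y - {\<one>} - K x" using z one_in_S by auto
  next
    fix z assume z: "z \<in> cyc y - {\<one>} - K x"
    then have zG: "z \<in> carrier G" using cyc_carrier yG by blast
    have zS: "z \<notin> S" using z disj by auto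
    have "comparable y z" using z by (auto simp: comparable_def)
    then have xz: "comparable x z" using K_comparable y zG by blast
    have "\<not> x \<in> cyc z"
    proof
      assume "x \<in> cyc z"
      moreover have "x \<in> K y" using Kx K_refl[OF x(1)] by simp
      ultimately have "z \<in> K y" using K_convex[OF yG yS] z by blast
      then show False using z Kx by simp
    qed
    then have "z \<in> cyc x" using xz by (auto simp: comparable_def)
    moreover have "x \<notin> K z" using z zG K_sym by blast
    ultimately show "z \<in> ?B"
      using graph_below_iff[OF zG zS x _ _] z zG zS xz comparable_sym by blast
  qed
  have "K x \<subseteq> cyc y - {\<one>}" using below x one_in_S K_S by blast
  moreover have "finite (cyc y)" using finite_cyc yG by blast
  moreover have "card (cyc y) > 0" using card_cyc ord_pos yG by simp
  ultimately have "1 + card (K x) + card ?B = card (cyc y)"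
    unfolding B using card_mono[of "cyc y - {\<one>}" "K x"] by (simp add: card_Diff_subset)
  then show thesis using that[OF y] card_cyc[OF yG] by (simp add: graph_ord_def)
qed

context
  fixes n m :: nat
  assumes order: "order G = n * m" "coprime n m" "n > 1" "m > 1"
begin

text \<open>The twins of \<open>x\<close> all have the same order, or their orders are nontrivial powers of one
prime, which divides only one of the coprime factors \<open>n\<close> and \<open>m\<close>. Hence
\<open>x\<close> is \<open>n\<close>-torsion exactly when its twin of largest order is, and that order is a
graph invariant.\<close>
lemma torsion_iff_graph_ord:
  assumes x: "x \<in> carrier G" "x \<notin> S"
  shows "x [^] n = \<one> \<longleftrightarrow> graph_ord (carrier G) comparable x dvd n"
proof -
  obtain p where p: "prime p" "p dvd n" using order(3) by (metis less_numeral_extra(4) prime_factor_nat)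
  obtain q where q: "prime q" "q dvd m" using order(4) by (metis less_numeral_extra(4) prime_factor_nat)
  have "p \<noteq> q" using p q order(2) by (metis coprime_common_divisor not_prime_unit)
  then obtain y where y: "y \<in> K x" "graph_ord (carrier G) comparable x = ord y"
    using graph_ord_eq[OF p(1) q(1) _ _ _ x] p q order(1) by (metis dvd_mult dvd_mult2)
  have yG: "y \<in> carrier G" using y K_carrier by blast
  have "ord x dvd n \<longleftrightarrow> ord y dvd n"
  proof (cases "K x = gens x")
    case True
    then show ?thesis using y by (simp add: gens_def)
  next
    case False
    obtain r where r: "prime r" "\<And>v. v \<in> carrier G \<Longrightarrow> comparable v x \<Longrightarrow> \<exists>k. ord v = r ^ k"
      using prime_power_nbrs[OF x False] by blast
    have *: "ord v dvd n \<longleftrightarrow> r dvd n" if v: "v \<in> K x" for v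
    proof -
      have vG: "v \<in> carrier G" using v K_carrier by blast
      obtain k where k: "ord v = r ^ k" using r(2) vG v K_nbr x by blast
      have "v \<noteq> \<one>" using v x K_S one_in_S by blast
      then have "k > 0" using k ord_eq_1[OF vG] by (auto intro: Nat.gr0I)
      moreover have "r ^ k dvd n * m" using ord_dvd_group_order[OF vG] order(1) k by simp
      ultimately show ?thesis using prime_power_dvd_coprime_factor_iff[OF r(1) order(2)] k by simp
    qed
    show ?thesis using *[OF y(1)] *[OF K_refl[OF x(1)]] by simp
  qed
  then show ?thesis using y x pow_eq_id by simp
qed

text \<open>The order of a dominating vertex other than the identity is divisible by the primes that divide
\<open>m\<close>, so it does not divide \<open>n\<close>.\<close>
lemma torsion_S:
  assumes s: "s \<in> S" "s [^] n = \<one>"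
  shows "s = \<one>"
proof (rule ccontr)
  assume s1: "s \<noteq> \<one>"
  obtain q where q: "prime q" "q dvd m" using order(4) by (metis less_numeral_extra(4) prime_factor_nat)
  then have "q dvd ord s" using S_ord_dvd[OF s(1) s1] order(1) by simp
  moreover have "ord s dvd n" using s S_carrier pow_eq_id by blast
  ultimately have "q dvd n" using dvd_trans by blast
  then show False using q order(2) by (metis coprime_common_divisor not_prime_unit)
qed

end

end

text \<open>Any isomorphism of power graphs maps the non-dominating \<open>n\<close>-torsion elements to each
other. Among the dominating vertices it may move the identity (for instance to a generator of a cyclic group),
but the identity is the only dominating \<open>n\<close>-torsion element, so redefining the map there repairs
it.\<close>
lemma restrict_comparability_iso_to_torsion:
  assumes "finite_group G" "finite_group H"
    and G: "order G = n * m" and H: "order H = n * m" and "coprime n m" "n > 1" "m > 1"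
    and bij: "bij_betw f (carrier G) (carrier H)"
    and iso: "\<And>x y. x \<in> carrier G \<Longrightarrow> y \<in> carrier G \<Longrightarrow>
      finite_group.comparable H (f x) (f y) \<longleftrightarrow> finite_group.comparable G x y"
  obtains g where
    "bij_betw g {x \<in> carrier G. x [^]\<^bsub>G\<^esub> n = \<one>\<^bsub>G\<^esub>} {x \<in> carrier H. x [^]\<^bsub>H\<^esub> n = \<one>\<^bsub>H\<^esub>}"
    "\<And>x y. \<lbrakk>x \<in> carrier G; x [^]\<^bsub>G\<^esub> n = \<one>\<^bsub>G\<^esub>; y \<in> carrier G; y [^]\<^bsub>G\<^esub> n = \<one>\<^bsub>G\<^esub>\<rbrakk> \<Longrightarrow>
      finite_group.comparable H (g x) (g y) \<longleftrightarrow> finite_group.comparable G x y"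
proof -
  interpret G: finite_group G by fact
  interpret H: finite_group H by fact
  let ?A = "{x \<in> carrier G. x [^]\<^bsub>G\<^esub> n = \<one>\<^bsub>G\<^esub>}" and ?B = "{x \<in> carrier H. x [^]\<^bsub>H\<^esub> n = \<one>\<^bsub>H\<^esub>}"
  have oG: "order G = n * m" "coprime n m" "n > 1" "m > 1" using assms by auto
  have oH: "order H = n * m" "coprime n m" "n > 1" "m > 1" using assms by auto
  have fS: "f x \<in> H.S \<longleftrightarrow> x \<in> G.S" if "x \<in> carrier G" for x
    using graph_iso_dominating[where c = G.comparable and c' = H.comparable, OF bij iso] that by blast
  have mem: "f x \<in> carrier H" if "x \<in> carrier G" for x using bij that by (auto simp: bij_betw_def)
  have tor: "f x \<in> ?B \<longleftrightarrow> x \<in> ?A" if x: "x \<in> carrier G" "x \<notin> G.S" for x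
    using G.torsion_iff_graph_ord[OF oG x] H.torsion_iff_graph_ord[OF oH mem[OF x(1)]]
      graph_iso_graph_ord[where c = G.comparable and c' = H.comparable, OF bij iso x(1)] fS[OF x(1)] x mem by auto
  have SA: "x \<in> G.S \<longleftrightarrow> x = \<one>\<^bsub>G\<^esub>" if "x \<in> ?A" for x
    using G.torsion_S[OF oG] that G.one_in_S by blast
  have SB: "x \<in> H.S \<longleftrightarrow> x = \<one>\<^bsub>H\<^esub>" if "x \<in> ?B" for x
    using H.torsion_S[OF oH] that H.one_in_S by blast
  have oneA: "\<one>\<^bsub>G\<^esub> \<in> ?A" and oneB: "\<one>\<^bsub>H\<^esub> \<in> ?B" by auto
  have img: "f ` (?A - {\<one>\<^bsub>G\<^esub>}) = ?B - {\<one>\<^bsub>H\<^esub>}"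
  proof (intro equalityI subsetI)
    fix b assume "b \<in> f ` (?A - {\<one>\<^bsub>G\<^esub>})"
    then obtain a where a: "b = f a" "a \<in> ?A" "a \<noteq> \<one>\<^bsub>G\<^esub>" by blast
    then have "a \<notin> G.S" using SA by blast
    moreover have "a \<in> carrier G" using a by blast
    ultimately have "f a \<in> ?B" "f a \<notin> H.S" using tor fS a(2) by blast+
    then show "b \<in> ?B - {\<one>\<^bsub>H\<^esub>}" using a(1) H.one_in_S by auto
  next
    fix b assume b: "b \<in> ?B - {\<one>\<^bsub>H\<^esub>}"
    then have bS: "b \<notin> H.S" using SB by blast
    have "b \<in> f ` carrier G" using b bij by (auto simp: bij_betw_def)
    then obtain a where a: "b = f a" "a \<in> carrier G" by blast
    then have "a \<notin> G.S" using bS fS by blast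
    moreover from this have "a \<in> ?A" using tor a b by blast
    ultimately show "b \<in> f ` (?A - {\<one>\<^bsub>G\<^esub>})" using a G.one_in_S by auto
  qed
  define g where "g = f(\<one>\<^bsub>G\<^esub> := \<one>\<^bsub>H\<^esub>)"
  have inj: "inj_on f (?A - {\<one>\<^bsub>G\<^esub>})" using bij by (auto simp: bij_betw_def inj_on_def)
  have "bij_betw g (insert \<one>\<^bsub>G\<^esub> (?A - {\<one>\<^bsub>G\<^esub>})) (insert \<one>\<^bsub>H\<^esub> (?B - {\<one>\<^bsub>H\<^esub>}))"
  proof -
    have "bij_betw g (?A - {\<one>\<^bsub>G\<^esub>}) (?B - {\<one>\<^bsub>H\<^esub>})"
      using inj img by (intro iffD2[OF bij_betw_cong[of _ g f]]) (auto simp: g_def bij_betw_def)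
    then show ?thesis using notIn_Un_bij_betw[of "\<one>\<^bsub>G\<^esub>" "?A - {\<one>\<^bsub>G\<^esub>}" g "?B - {\<one>\<^bsub>H\<^esub>}"]
      by (simp add: g_def)
  qed
  then have gbij: "bij_betw g ?A ?B" using oneA oneB by (simp add: insert_absorb)
  have "H.comparable (g x) (g y) \<longleftrightarrow> G.comparable x y" if "x \<in> ?A" "y \<in> ?A" for x y
    using that iso by (auto simp: g_def H.comparable_def G.comparable_def)
  then show thesis using that gbij by blast
qed

section \<open>Digraph isomorphisms as bijections of vertices\<close>

lemma bij_betw_lift:
  assumes "bij_betw i X A" "bij_betw k Y B" "bij_betw \<phi> A B"
  obtains \<psi> where "bij_betw \<psi> X Y" "\<And>x. x \<in> X \<Longrightarrow> k (\<psi> x) = \<phi> (i x)"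
proof -
  have 1: "bij_betw (\<phi> \<circ> i) X B" using assms bij_betw_trans by blast
  have "bij_betw (inv_into Y k \<circ> (\<phi> \<circ> i)) X Y"
    using bij_betw_trans[OF 1 bij_betw_inv_into[OF assms(2)]] .
  moreover have "k ((inv_into Y k \<circ> (\<phi> \<circ> i)) x) = \<phi> (i x)" if "x \<in> X" for x
  proof -
    have "\<phi> (i x) \<in> k ` Y" using bij_betw_imp_surj_on[OF 1] bij_betw_imp_surj_on[OF assms(2)] that by auto
    then show ?thesis by (simp add: f_inv_into_f)
  qed
  ultimately show thesis using that by blast
qed

lemma bij_betw_restrict_pred:
  assumes "bij_betw f X Y" "\<And>x. x \<in> X \<Longrightarrow> Q (f x) \<longleftrightarrow> P x"
  shows "bij_betw f {x \<in> X. P x} {y \<in> Y. Q y}"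
  using assms by (auto simp: bij_betw_def inj_on_def)

lemma inj_on_image_psubset_iff:
  assumes inj: "inj_on f X" and AB: "A \<subseteq> X" "B \<subseteq> X"
  shows "f ` A \<subset> f ` B \<longleftrightarrow> A \<subset> B"
proof -
  have "f ` C \<subseteq> f ` D \<longleftrightarrow> C \<subseteq> D" if "C \<subseteq> X" "D \<subseteq> X" for C D
    using inj_on_image_mem_iff[OF inj] that by blast
  then show ?thesis using AB by (simp add: less_le_not_le)
qed

text \<open>Choosing a bijection on each fibre gives a bijection over the common base.\<close>
lemma fibrewise_bij:
  assumes fin: "finite X" "finite Y"
    and card: "\<And>b. card {x \<in> X. p x = b} = card {y \<in> Y. q y = b}"
  obtains h where "bij_betw h X Y" "\<And>x. x \<in> X \<Longrightarrow> q (h x) = p x"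
proof -
  have "\<exists>g. bij_betw g {x \<in> X. p x = b} {y \<in> Y. q y = b}" for b
    using fin card by (intro finite_same_card_bij) auto
  then obtain g where g: "\<And>b. bij_betw (g b) {x \<in> X. p x = b} {y \<in> Y. q y = b}" by metis
  define h where "h x = g (p x) x" for x
  have h: "h x \<in> Y \<and> q (h x) = p x" if "x \<in> X" for x
    using bij_betwE[OF g[of "p x"]] that by (auto simp: h_def)
  have "inj_on h X"
  proof (rule inj_onI)
    fix x y assume xy: "x \<in> X" "y \<in> X" "h x = h y"
    then have "p x = p y" using h by metis
    then show "x = y" using xy bij_betw_imp_inj_on[OF g[of "p x"]] by (auto simp: h_def inj_on_def)
  qed
  moreover have "y \<in> h ` X" if "y \<in> Y" for y
  proof -
    have "y \<in> g (q y) ` {x \<in> X. p x = q y}" using bij_betw_imp_surj_on[OF g[of "q y"]] that by auto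
    then obtain x where "x \<in> X" "y = h x" by (auto simp: h_def)
    then show ?thesis by blast
  qed
  ultimately have "bij_betw h X Y" using h by (auto simp: bij_betw_def)
  then show thesis using that h by blast
qed

lemma weighted_digraph_iso_with_proj_iff:
  assumes P: "wf_digraph (with_proj P)" and Q: "wf_digraph (with_proj Q)"
  shows "weighted_digraph_iso w (with_proj P) w' (with_proj Q) \<longleftrightarrow>
    (\<exists>f. bij_betw f (pverts P) (pverts Q) \<and>
      (\<forall>u \<in> pverts P. \<forall>v \<in> pverts P. (f u, f v) \<in> parcs Q \<longleftrightarrow> (u, v) \<in> parcs P) \<and>
      (\<forall>v \<in> pverts P. w' (f v) = w v))"
    (is "?L \<longleftrightarrow> ?R")
proof
  have wfP: "u \<in> pverts P" "v \<in> pverts P" if "(u, v) \<in> parcs P" for u v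
    using wf_digraph.tail_in_verts[OF P] wf_digraph.head_in_verts[OF P] that by force+
  have wfQ: "u \<in> pverts Q" "v \<in> pverts Q" if "(u, v) \<in> parcs Q" for u v
    using wf_digraph.tail_in_verts[OF Q] wf_digraph.head_in_verts[OF Q] that by force+
  {
    assume ?L
    then obtain h where h: "pre_digraph.digraph_isomorphism (with_proj P) h"
      and Qh: "with_proj Q = app_iso h (with_proj P)"
      and w: "\<forall>v \<in> pverts P. w' (iso_verts h v) = w v"
      by (auto simp: weighted_digraph_iso_def)
    have "verts (with_proj Q) = iso_verts h ` pverts P" "arcs (with_proj Q) = iso_arcs h ` parcs P"
      "tail (with_proj Q) = iso_tail h" "head (with_proj Q) = iso_head h"
      unfolding Qh by simp_all
    then have eqs: "pverts Q = iso_verts h ` pverts P" "parcs Q = iso_arcs h ` parcs P"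
      "iso_tail h = fst" "iso_head h = snd"
      by simp_all
    have inj: "inj_on (iso_verts h) (pverts P)"
      using h by (simp add: pre_digraph.digraph_isomorphism_def)
    have arc: "iso_arcs h (u, v) = (iso_verts h u, iso_verts h v)" if "(u, v) \<in> parcs P" for u v
      using h that eqs(3,4) by (auto simp: pre_digraph.digraph_isomorphism_def prod_eq_iff)
    have "(iso_verts h u, iso_verts h v) \<in> parcs Q \<longleftrightarrow> (u, v) \<in> parcs P"
      if uv: "u \<in> pverts P" "v \<in> pverts P" for u v
    proof
      assume "(iso_verts h u, iso_verts h v) \<in> parcs Q"
      then obtain u' v' where a: "(u', v') \<in> parcs P" "(iso_verts h u, iso_verts h v) = iso_arcs h (u', v')"
        using eqs(2) by auto
      then have "iso_verts h u = iso_verts h u'" "iso_verts h v = iso_verts h v'" using arc by auto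
      then have "u = u'" "v = v'" using inj uv wfP[OF a(1)] by (auto dest: inj_onD)
      then show "(u, v) \<in> parcs P" using a by simp
    next
      assume "(u, v) \<in> parcs P"
      then show "(iso_verts h u, iso_verts h v) \<in> parcs Q" using arc eqs(2) by force
    qed
    then show ?R using inj eqs(1) w by (auto simp: bij_betw_def intro!: exI[of _ "iso_verts h"])
  }
  assume ?R
  then obtain f where f: "bij_betw f (pverts P) (pverts Q)"
    and arcs: "\<And>u v. u \<in> pverts P \<Longrightarrow> v \<in> pverts P \<Longrightarrow> (f u, f v) \<in> parcs Q \<longleftrightarrow> (u, v) \<in> parcs P"
    and w: "\<forall>v \<in> pverts P. w' (f v) = w v" by blast
  define h where "h = \<lparr>iso_verts = f, iso_arcs = map_prod f f, iso_head = snd, iso_tail = fst\<rparr>"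
  have inj: "inj_on f (pverts P)" and img: "f ` pverts P = pverts Q" using f by (auto simp: bij_betw_def)
  have "inj_on (map_prod f f) (parcs P)"
    by (rule inj_on_subset[OF map_prod_inj_on[OF inj inj]]) (use wfP in auto)
  then have "pre_digraph.digraph_isomorphism (with_proj P) h"
    using P inj by (auto simp: pre_digraph.digraph_isomorphism_def h_def)
  moreover have "map_prod f f ` parcs P = parcs Q"
  proof (intro equalityI subsetI)
    fix a assume "a \<in> map_prod f f ` parcs P"
    then show "a \<in> parcs Q" using arcs wfP by auto
  next
    fix a assume a: "a \<in> parcs Q"
    obtain x y where xy: "a = (x, y)" by (cases a)
    then obtain u v where "x = f u" "y = f v" "u \<in> pverts P" "v \<in> pverts P"
      using wfQ[of x y] a img by blast
    then show "a \<in> map_prod f f ` parcs P" using arcs a xy by force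
  qed
  then have "with_proj Q = app_iso h (with_proj P)"
    using img by (simp add: h_def app_iso_def with_proj_def)
  ultimately show ?L using w by (auto simp: weighted_digraph_iso_def h_def)
qed

lemma digraph_iso_with_proj_iff:
  assumes "wf_digraph (with_proj P)" and "wf_digraph (with_proj Q)"
  shows "digraph_iso (with_proj P) (with_proj Q) \<longleftrightarrow>
    (\<exists>f. bij_betw f (pverts P) (pverts Q) \<and>
      (\<forall>u \<in> pverts P. \<forall>v \<in> pverts P. (f u, f v) \<in> parcs Q \<longleftrightarrow> (u, v) \<in> parcs P))"
  using weighted_digraph_iso_with_proj_iff[OF assms, of "\<lambda>_. 0" "\<lambda>_. 0"]
  by (simp add: weighted_digraph_iso_def digraph_iso_def)

section \<open>Coprime factors as torsion sets\<close>

text \<open>A factor of a direct product of coprime order is the set of elements of the product whose order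
divides the order of that factor. Working with such embeddings treats both factors alike.\<close>
locale torsion_embedding = finite_group G + G1: finite_group G1
  for G1 :: "('a, 'm) monoid_scheme" and G :: "('b, 'n) monoid_scheme" (structure) +
  fixes \<iota> :: "'a \<Rightarrow> 'b" and n :: nat
  assumes hom: "\<iota> \<in> hom G1 G" and inj: "inj_on \<iota> (carrier G1)"
    and image: "\<iota> ` carrier G1 = {x \<in> carrier G. x [^] n = \<one>}"
begin

lemma closed [simp]: "a \<in> carrier G1 \<Longrightarrow> \<iota> a \<in> carrier G"
  using image by blast

lemma bij: "bij_betw \<iota> (carrier G1) {x \<in> carrier G. x [^] n = \<one>}"
  using inj image by (simp add: bij_betw_def)

lemma map_int_pow: "a \<in> carrier G1 \<Longrightarrow> \<iota> (a [^]\<^bsub>G1\<^esub> (k::int)) = \<iota> a [^] k"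
  using hom_int_pow[OF hom] G1.is_group is_group by blast

lemma eq_iff: "a \<in> carrier G1 \<Longrightarrow> b \<in> carrier G1 \<Longrightarrow> \<iota> a = \<iota> b \<longleftrightarrow> a = b"
  using inj by (auto dest: inj_onD)

lemma map_cyc: "a \<in> carrier G1 \<Longrightarrow> \<iota> ` generate G1 {a} = generate G {\<iota> a}"
  using generate_pow[of "\<iota> a"] G1.generate_pow[of a] map_int_pow[of a] by (auto simp: image_iff) metis

lemma map_ord: 
  assumes a: "a \<in> carrier G1"
  shows "ord (\<iota> a) = group.ord G1 a"
proof -
  have "card (\<iota> ` generate G1 {a}) = card (generate G1 {a})"
    by (rule card_image, rule inj_on_subset[OF inj]) (use G1.cyc_closed a in auto)
  then show ?thesis using map_cyc a generate_pow_card G1.generate_pow_card by simp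
qed

lemma map_comparable:
  assumes "a \<in> carrier G1" "b \<in> carrier G1"
  shows "comparable (\<iota> a) (\<iota> b) \<longleftrightarrow> G1.comparable a b"
proof -
  have "\<iota> x \<in> cyc (\<iota> y) \<longleftrightarrow> x \<in> G1.cyc y" if "x \<in> carrier G1" "y \<in> carrier G1" for x y
    unfolding map_cyc[OF that(2), symmetric]
    using inj_on_image_mem_iff[OF inj that(1)] G1.cyc_closed that by blast
  then show ?thesis using assms by (simp add: comparable_def G1.comparable_def)
qed

lemma order_multiset_eq: "order_multiset G1 = filter_mset (\<lambda>d. d dvd n) (order_multiset G)"
proof -
  have "order_multiset G1 = image_mset (\<lambda>a. ord (\<iota> a)) (mset_set (carrier G1))"
    unfolding order_multiset_def by (intro image_mset_cong) (simp add: map_ord)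
  also have "\<dots> = image_mset ord (image_mset \<iota> (mset_set (carrier G1)))"
    by (simp add: multiset.map_comp o_def)
  also have "\<dots> = image_mset ord (mset_set {x \<in> carrier G. x [^] n = \<one>})"
    using inj image by (simp add: image_mset_mset_set)
  also have "{x \<in> carrier G. x [^] n = \<one>} = {x \<in> carrier G. ord x dvd n}"
    using pow_eq_id by auto
  finally show ?thesis
    by (simp add: order_multiset_def filter_mset_image_mset filter_mset_mset_set)
qed

text \<open>A cyclic subgroup lies in the image exactly when its generators do, that is, when its order divides
\<open>n\<close>. So the weights in the digraph of cyclic subgroups single out the vertices that come from the
factor.\<close>
lemma bij_cyclic_subgroups:
  "bij_betw ((`) \<iota>) (cyclic_subgroups G1) {C \<in> cyclic_subgroups G. card C dvd n}"
proof -
  have sub: "C \<subseteq> carrier G1" if "C \<in> cyclic_subgroups G1" for C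
    using that by (auto simp: G1.cyclic_subgroups_eq dest: G1.cyc_carrier)
  have "inj_on ((`) \<iota>) (cyclic_subgroups G1)"
    using sub inj by (intro inj_onI) (simp add: inj_on_image_eq_iff)
  moreover have "(`) \<iota> ` cyclic_subgroups G1 = (\<lambda>x. cyc x) ` \<iota> ` carrier G1"
    unfolding G1.cyclic_subgroups_eq image_image by (rule image_cong) (simp_all add: map_cyc)
  moreover have "\<dots> = {C \<in> cyclic_subgroups G. card C dvd n}"
    unfolding image cyclic_subgroups_eq by (auto simp: pow_eq_id card_cyc)
  ultimately show ?thesis by (simp add: bij_betw_def)
qed

end

locale torsion_embedding_pair =
  G: torsion_embedding G1 G \<iota> n + H: torsion_embedding H1 H \<kappa> n
  for G1 :: "('a, 'm) monoid_scheme" and G :: "('b, 'n) monoid_scheme"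
    and H1 :: "('c, 'k) monoid_scheme" and H :: "('d, 'l) monoid_scheme" and \<iota> \<kappa> n
begin

lemma lift_torsion_bij:
  assumes "bij_betw \<phi> {x \<in> carrier G. x [^]\<^bsub>G\<^esub> n = \<one>\<^bsub>G\<^esub>} {x \<in> carrier H. x [^]\<^bsub>H\<^esub> n = \<one>\<^bsub>H\<^esub>}"
  obtains \<psi> where "bij_betw \<psi> (carrier G1) (carrier H1)"
    "\<And>a. a \<in> carrier G1 \<Longrightarrow> \<kappa> (\<psi> a) = \<phi> (\<iota> a)"
  using bij_betw_lift[OF G.bij H.bij assms] by blast

lemma iso_restrict:
  assumes "G \<cong> H"
  shows "G1 \<cong> H1"
proof -
  obtain \<phi> where phi: "\<phi> \<in> hom G H" "bij_betw \<phi> (carrier G) (carrier H)"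
    using assms by (auto simp: is_iso_def iso_def)
  interpret phi: group_hom G H \<phi>
    using phi(1) by unfold_locales
  have "bij_betw \<phi> {x \<in> carrier G. x [^]\<^bsub>G\<^esub> n = \<one>\<^bsub>G\<^esub>} {x \<in> carrier H. x [^]\<^bsub>H\<^esub> n = \<one>\<^bsub>H\<^esub>}"
  proof (rule bij_betw_restrict_pred[OF phi(2)])
    fix x assume x: "x \<in> carrier G"
    have "\<phi> (x [^]\<^bsub>G\<^esub> n) = \<phi> \<one>\<^bsub>G\<^esub> \<longleftrightarrow> x [^]\<^bsub>G\<^esub> n = \<one>\<^bsub>G\<^esub>"
      using x inj_onD[OF bij_betw_imp_inj_on[OF phi(2)]] by auto
    then show "\<phi> x [^]\<^bsub>H\<^esub> n = \<one>\<^bsub>H\<^esub> \<longleftrightarrow> x [^]\<^bsub>G\<^esub> n = \<one>\<^bsub>G\<^esub>"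
      using x by (simp add: phi.hom_nat_pow)
  qed
  then obtain \<psi> where psi: "bij_betw \<psi> (carrier G1) (carrier H1)"
    "\<And>a. a \<in> carrier G1 \<Longrightarrow> \<kappa> (\<psi> a) = \<phi> (\<iota> a)" using lift_torsion_bij by blast
  have cl: "\<psi> a \<in> carrier H1" if "a \<in> carrier G1" for a using psi(1) that by (auto simp: bij_betw_def)
  have "\<psi> \<in> hom G1 H1"
  proof (rule homI)
    fix a b assume ab: "a \<in> carrier G1" "b \<in> carrier G1"
    have "\<kappa> (\<psi> (a \<otimes>\<^bsub>G1\<^esub> b)) = \<kappa> (\<psi> a \<otimes>\<^bsub>H1\<^esub> \<psi> b)"
      using ab cl psi(2) hom_mult[OF G.hom] hom_mult[OF H.hom] hom_mult[OF phi(1)] by simp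
    then show "\<psi> (a \<otimes>\<^bsub>G1\<^esub> b) = \<psi> a \<otimes>\<^bsub>H1\<^esub> \<psi> b" using H.eq_iff ab cl by simp
  qed (use cl in blast)
  then show ?thesis using psi(1) by (auto simp: is_iso_def iso_def)
qed

lemma power_equivalent_restrict:
  assumes "power_equivalent G H"
  shows "power_equivalent G1 H1"
proof -
  obtain \<phi> where bij: "bij_betw \<phi> (carrier G) (carrier H)"
    and pow: "\<And>g t. g \<in> carrier G \<Longrightarrow> \<phi> (g [^]\<^bsub>G\<^esub> (t::int)) = \<phi> g [^]\<^bsub>H\<^esub> t"
    using assms by (auto simp: power_equivalent_def)
  have cl: "\<phi> x \<in> carrier H" if "x \<in> carrier G" for x using bij that by (auto simp: bij_betw_def)
  have one: "\<phi> \<one>\<^bsub>G\<^esub> = \<one>\<^bsub>H\<^esub>" using pow[of "\<one>\<^bsub>G\<^esub>" 0] cl by simp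
  have "bij_betw \<phi> {x \<in> carrier G. x [^]\<^bsub>G\<^esub> n = \<one>\<^bsub>G\<^esub>} {x \<in> carrier H. x [^]\<^bsub>H\<^esub> n = \<one>\<^bsub>H\<^esub>}"
  proof (rule bij_betw_restrict_pred[OF bij])
    fix x assume x: "x \<in> carrier G"
    have "\<phi> (x [^]\<^bsub>G\<^esub> n) = \<phi> \<one>\<^bsub>G\<^esub> \<longleftrightarrow> x [^]\<^bsub>G\<^esub> n = \<one>\<^bsub>G\<^esub>"
      using x inj_onD[OF bij_betw_imp_inj_on[OF bij]] by auto
    then show "\<phi> x [^]\<^bsub>H\<^esub> n = \<one>\<^bsub>H\<^esub> \<longleftrightarrow> x [^]\<^bsub>G\<^esub> n = \<one>\<^bsub>G\<^esub>"
      using x pow[of x "int n"] one by (simp add: int_pow_int)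
  qed
  then obtain \<psi> where psi: "bij_betw \<psi> (carrier G1) (carrier H1)"
    "\<And>a. a \<in> carrier G1 \<Longrightarrow> \<kappa> (\<psi> a) = \<phi> (\<iota> a)" using lift_torsion_bij by blast
  have cl1: "\<psi> a \<in> carrier H1" if "a \<in> carrier G1" for a using psi(1) that by (auto simp: bij_betw_def)
  have "\<psi> (a [^]\<^bsub>G1\<^esub> t) = \<psi> a [^]\<^bsub>H1\<^esub> t" if a: "a \<in> carrier G1" for a and t :: int
  proof -
    have "\<kappa> (\<psi> (a [^]\<^bsub>G1\<^esub> t)) = \<kappa> (\<psi> a [^]\<^bsub>H1\<^esub> t)"
      using a cl1 psi(2) G.map_int_pow H.map_int_pow pow by simp
    then show ?thesis using H.eq_iff a cl1 by simp
  qed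
  then show ?thesis using psi(1) by (auto simp: power_equivalent_def)
qed

lemma order_multiset_restrict:
  "order_multiset G = order_multiset H \<Longrightarrow> order_multiset G1 = order_multiset H1"
  by (simp add: G.order_multiset_eq H.order_multiset_eq)

lemma cyclic_subgroup_digraph_restrict:
  assumes "weighted_digraph_iso card (with_proj (cyclic_subgroup_digraph G))
    card (with_proj (cyclic_subgroup_digraph H))"
  shows "weighted_digraph_iso card (with_proj (cyclic_subgroup_digraph G1))
    card (with_proj (cyclic_subgroup_digraph H1))"
proof -
  obtain f where f: "bij_betw f (cyclic_subgroups G) (cyclic_subgroups H)"
    and less: "\<And>C D. C \<in> cyclic_subgroups G \<Longrightarrow> D \<in> cyclic_subgroups G \<Longrightarrow> f D \<subset> f C \<longleftrightarrow> D \<subset> C"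
    and card: "\<And>C. C \<in> cyclic_subgroups G \<Longrightarrow> card (f C) = card C"
  proof -
    obtain f where "bij_betw f (cyclic_subgroups G) (cyclic_subgroups H)"
      "\<forall>u\<in>cyclic_subgroups G. \<forall>v\<in>cyclic_subgroups G.
        (f u \<in> cyclic_subgroups H \<and> f v \<in> cyclic_subgroups H \<and> f v \<subset> f u) \<longleftrightarrow> v \<subset> u"
      "\<forall>v\<in>cyclic_subgroups G. card (f v) = card v"
      using assms unfolding weighted_digraph_iso_with_proj_iff[OF wf_cyclic_subgroup_digraph wf_cyclic_subgroup_digraph]
      by (auto simp: cyclic_subgroup_digraph_def)
    then show thesis using that[of f] bij_betwE by metis
  qed
  have "bij_betw f {C \<in> cyclic_subgroups G. card C dvd n} {C \<in> cyclic_subgroups H. card C dvd n}"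
    using f by (rule bij_betw_restrict_pred) (simp add: card)
  then obtain \<psi> where psi: "bij_betw \<psi> (cyclic_subgroups G1) (cyclic_subgroups H1)"
    "\<And>C. C \<in> cyclic_subgroups G1 \<Longrightarrow> \<kappa> ` \<psi> C = f (\<iota> ` C)"
    using bij_betw_lift[OF G.bij_cyclic_subgroups H.bij_cyclic_subgroups] by blast
  have mem: "\<psi> C \<in> cyclic_subgroups H1" if "C \<in> cyclic_subgroups G1" for C
    using psi(1) that by (auto simp: bij_betw_def)
  have memG: "\<iota> ` C \<in> cyclic_subgroups G" if "C \<in> cyclic_subgroups G1" for C
    using G.bij_cyclic_subgroups that by (auto simp: bij_betw_def)
  have subG: "C \<subseteq> carrier G1" if "C \<in> cyclic_subgroups G1" for C
    using that by (auto simp: G.G1.cyclic_subgroups_eq dest: G.G1.cyc_carrier)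
  have subH: "C \<subseteq> carrier H1" if "C \<in> cyclic_subgroups H1" for C
    using that by (auto simp: H.G1.cyclic_subgroups_eq dest: H.G1.cyc_carrier)
  have "\<psi> D \<subset> \<psi> C \<longleftrightarrow> D \<subset> C" if CD: "C \<in> cyclic_subgroups G1" "D \<in> cyclic_subgroups G1" for C D
  proof -
    have "\<psi> D \<subset> \<psi> C \<longleftrightarrow> \<kappa> ` \<psi> D \<subset> \<kappa> ` \<psi> C"
      using inj_on_image_psubset_iff[OF H.inj] subH mem CD by metis
    also have "\<dots> \<longleftrightarrow> \<iota> ` D \<subset> \<iota> ` C" using psi(2) less memG CD by simp
    also have "\<dots> \<longleftrightarrow> D \<subset> C"
      using inj_on_image_psubset_iff[OF G.inj] subG CD by metis
    finally show ?thesis .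
  qed
  moreover have "card (\<psi> C) = card C" if C: "C \<in> cyclic_subgroups G1" for C
  proof -
    have "card (\<psi> C) = card (\<kappa> ` \<psi> C)"
      using card_image[OF inj_on_subset[OF H.inj subH[OF mem[OF C]]]] by simp
    also have "\<dots> = card (\<iota> ` C)" using psi(2) card memG C by simp
    also have "\<dots> = card C" using card_image[OF inj_on_subset[OF G.inj subG[OF C]]] by simp
    finally show ?thesis .
  qed
  ultimately show ?thesis
    unfolding weighted_digraph_iso_with_proj_iff[OF wf_cyclic_subgroup_digraph wf_cyclic_subgroup_digraph]
    using psi(1) mem by (intro exI[of _ \<psi>]) (auto simp: cyclic_subgroup_digraph_def)
qed

end

section \<open>Power graphs of coprime factors\<close>

lemma (in finite_group) power_graph_arc_iff:
  "(x, y) \<in> parcs (power_graph G) \<longleftrightarrow> x \<in> carrier G \<and> y \<in> carrier G \<and> x \<noteq> y \<and> comparable x y"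
proof -
  have "comparable x y \<longleftrightarrow> (\<exists>k::int. x = y [^] k \<or> y = x [^] k)" if "x \<in> carrier G" "y \<in> carrier G"
    using that by (auto simp: comparable_def generate_pow)
  then show ?thesis by (auto simp: power_graph_def)
qed

lemma power_graph_iso_iff:
  assumes "finite_group G" "finite_group H"
  shows "digraph_iso (with_proj (power_graph G)) (with_proj (power_graph H)) \<longleftrightarrow>
    (\<exists>f. bij_betw f (carrier G) (carrier H) \<and>
      (\<forall>x \<in> carrier G. \<forall>y \<in> carrier G.
        finite_group.comparable H (f x) (f y) \<longleftrightarrow> finite_group.comparable G x y))"
proof -
  interpret G: finite_group G by fact
  interpret H: finite_group H by fact
  have verts: "pverts (power_graph G) = carrier G" "pverts (power_graph H) = carrier H"
    by (simp_all add: power_graph_def)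
  have "(\<forall>x \<in> carrier G. \<forall>y \<in> carrier G. (f x, f y) \<in> parcs (power_graph H) \<longleftrightarrow> (x, y) \<in> parcs (power_graph G)) \<longleftrightarrow>
    (\<forall>x \<in> carrier G. \<forall>y \<in> carrier G. H.comparable (f x) (f y) \<longleftrightarrow> G.comparable x y)"
    if f: "bij_betw f (carrier G) (carrier H)" for f
  proof -
    have "f x \<in> carrier H" if "x \<in> carrier G" for x using f that by (auto simp: bij_betw_def)
    moreover have "f x = f y \<longleftrightarrow> x = y" if "x \<in> carrier G" "y \<in> carrier G" for x y
      using f that by (auto simp: bij_betw_def dest: inj_onD)
    ultimately show ?thesis
      unfolding G.power_graph_arc_iff H.power_graph_arc_iff
      by (intro ball_cong refl) (metis G.comparable_refl H.comparable_refl)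
  qed
  then show ?thesis
    unfolding digraph_iso_with_proj_iff[OF sym_power_graph(1) sym_power_graph(1)] verts
    by (metis (lifting))
qed

lemma (in torsion_embedding_pair) power_graph_restrict:
  assumes G: "order G = n * m" and H: "order H = n * m" and cop: "coprime n m"
    and iso: "digraph_iso (with_proj (power_graph G)) (with_proj (power_graph H))"
  shows "digraph_iso (with_proj (power_graph G1)) (with_proj (power_graph H1))"
proof -
  note fg = G.finite_group_axioms H.finite_group_axioms
  let ?A = "{x \<in> carrier G. x [^]\<^bsub>G\<^esub> n = \<one>\<^bsub>G\<^esub>}" and ?B = "{x \<in> carrier H. x [^]\<^bsub>H\<^esub> n = \<one>\<^bsub>H\<^esub>}"
  obtain f where f: "bij_betw f (carrier G) (carrier H)"
    and cmp: "\<And>x y. x \<in> carrier G \<Longrightarrow> y \<in> carrier G \<Longrightarrow> H.comparable (f x) (f y) \<longleftrightarrow> G.comparable x y"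
    using iso unfolding power_graph_iso_iff[OF fg] by blast
  have pos: "n > 0" "m > 0" using G G.order_gt_0_iff_finite by auto
  have "\<exists>g. bij_betw g ?A ?B \<and> (\<forall>x\<in>?A. \<forall>y\<in>?A. H.comparable (g x) (g y) \<longleftrightarrow> G.comparable x y)"
  proof -
    \<comment> \<open>If a factor is trivial, the group may be a \<open>p\<close>-group, where element orders
      cannot be read off; but then the torsion set is trivial or everything.\<close>
    consider "n = 1" | "m = 1" | "n > 1" "m > 1" using pos by linarith
    then show ?thesis
    proof cases
      case 1
      then have "?A = {\<one>\<^bsub>G\<^esub>}" "?B = {\<one>\<^bsub>H\<^esub>}" by auto
      then show ?thesis by (intro exI[of _ "\<lambda>_. \<one>\<^bsub>H\<^esub>"]) (simp add: bij_betw_def)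
    next
      case 2
      then have "?A = carrier G" "?B = carrier H"
        using G.pow_order_eq_1 H.pow_order_eq_1 G H by auto
      then show ?thesis using f cmp by auto
    next
      case 3
      obtain g where "bij_betw g ?A ?B"
        "\<And>x y. \<lbrakk>x \<in> carrier G; x [^]\<^bsub>G\<^esub> n = \<one>\<^bsub>G\<^esub>; y \<in> carrier G; y [^]\<^bsub>G\<^esub> n = \<one>\<^bsub>G\<^esub>\<rbrakk> \<Longrightarrow>
          H.comparable (g x) (g y) \<longleftrightarrow> G.comparable x y"
        using restrict_comparability_iso_to_torsion[OF fg G H cop 3 f cmp] by blast
      then show ?thesis by blast
    qed
  qed
  then obtain g where g: "bij_betw g ?A ?B"
    and gcmp: "\<And>x y. x \<in> ?A \<Longrightarrow> y \<in> ?A \<Longrightarrow> H.comparable (g x) (g y) \<longleftrightarrow> G.comparable x y" by blast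
  obtain \<psi> where psi: "bij_betw \<psi> (carrier G1) (carrier H1)"
    "\<And>a. a \<in> carrier G1 \<Longrightarrow> \<kappa> (\<psi> a) = g (\<iota> a)" using lift_torsion_bij[OF g] by blast
  have "H.G1.comparable (\<psi> a) (\<psi> b) \<longleftrightarrow> G.G1.comparable a b"
    if ab: "a \<in> carrier G1" "b \<in> carrier G1" for a b
  proof -
    have "\<psi> a \<in> carrier H1" "\<psi> b \<in> carrier H1" using psi(1) ab by (auto simp: bij_betw_def)
    then have "H.G1.comparable (\<psi> a) (\<psi> b) \<longleftrightarrow> H.comparable (g (\<iota> a)) (g (\<iota> b))"
      using H.map_comparable[of "\<psi> a" "\<psi> b"] psi(2) ab by simp
    also have "\<dots> \<longleftrightarrow> G.comparable (\<iota> a) (\<iota> b)"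
      using gcmp ab G.image by blast
    also have "\<dots> \<longleftrightarrow> G.G1.comparable a b" using G.map_comparable ab by blast
    finally show ?thesis .
  qed
  then show ?thesis
    unfolding power_graph_iso_iff[OF G.G1.finite_group_axioms H.G1.finite_group_axioms]
    using psi(1) by blast
qed

section \<open>Cancellation for graphs of power maps\<close>

text \<open>The self-map \<open>F\<close> of \<open>Z\<close> looks like \<open>f\<close> on a copy of
\<open>X\<close>, takes all its values in that copy, and has \<open>m\<close> times as many preimages there. Its
functional graph is that of \<open>f\<close> with additional leaves. The example is the map \<open>(x, y)
\<mapsto> (f x, e)\<close> on a product with a set of \<open>m\<close> elements.\<close>
locale inflation =
  fixes X :: "'a set" and f :: "'a \<Rightarrow> 'a" and Z :: "'b set" and F :: "'b \<Rightarrow> 'b"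
    and \<iota> :: "'a \<Rightarrow> 'b" and m :: nat
  assumes finite_X: "finite X" and f_closed: "x \<in> X \<Longrightarrow> f x \<in> X"
    and inj: "inj_on \<iota> X" and \<iota>_closed: "x \<in> X \<Longrightarrow> \<iota> x \<in> Z"
    and semiconj: "x \<in> X \<Longrightarrow> F (\<iota> x) = \<iota> (f x)"
    and range: "z \<in> Z \<Longrightarrow> F z \<in> \<iota> ` X"
    and card_fibre: "a \<in> X \<Longrightarrow> card {z \<in> Z. F z = \<iota> a} = m * card {x \<in> X. f x = a}"
    and finite_Z: "finite Z" and m_pos: "m > 0"
begin

lemma image_eq: "\<iota> ` f ` X = F ` Z"
proof (intro equalityI subsetI)
  fix z assume "z \<in> \<iota> ` f ` X"
  then obtain x where "x \<in> X" "z = F (\<iota> x)" using semiconj by auto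
  then show "z \<in> F ` Z" using \<iota>_closed by blast
next
  fix z assume "z \<in> F ` Z"
  then obtain w where w: "w \<in> Z" "z = F w" by blast
  then obtain a where a: "a \<in> X" "z = \<iota> a" using range by auto
  have "card {z \<in> Z. F z = \<iota> a} > 0" using w a finite_Z by (auto simp: card_gt_0_iff)
  then have "{x \<in> X. f x = a} \<noteq> {}" using card_fibre[OF a(1)] by (auto simp del: Collect_empty_eq)
  then show "z \<in> \<iota> ` f ` X" using a by blast
qed

lemma bij_image: "bij_betw \<iota> (f ` X) (F ` Z)"
  using inj f_closed image_eq inj_on_subset[OF inj, of "f ` X"] by (auto simp: bij_betw_def)

lemma card_leaves:
  "card {x \<in> X - f ` X. f x = a} = card {x \<in> X. f x = a} - card {x \<in> f ` X. f x = a}"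
proof -
  have "{x \<in> X - f ` X. f x = a} = {x \<in> X. f x = a} - {x \<in> f ` X. f x = a}" by blast
  moreover have "{x \<in> f ` X. f x = a} \<subseteq> {x \<in> X. f x = a}" using f_closed by blast
  ultimately show ?thesis using finite_X by (simp add: card_Diff_subset)
qed

end

text \<open>The copy of \<open>X\<close> cannot be recognised inside the graph of \<open>F\<close>, but its
non-leaves can: the image of \<open>F\<close> is a copy of the image of \<open>f\<close>. This yields a
conjugacy \<open>\<theta>\<close> of the two images, and the fibres of \<open>f\<close> and \<open>g\<close>
over corresponding points have the same size because those of \<open>F\<close> and \<open>H\<close> do.
Subtracting the points of the fibre that lie in the image, the leaves of \<open>f\<close> and \<open>g\<close>
attached to corresponding points are equally many, so \<open>\<theta>\<close> extends to the leaves.\<close>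
lemma inflation_conjugacy_cancel:
  assumes "inflation X f Z F \<iota> m" and "inflation Y g W H \<kappa> m"
    and psi: "bij_betw \<psi> Z W" and conj: "\<And>z. z \<in> Z \<Longrightarrow> \<psi> (F z) = H (\<psi> z)"
  obtains \<theta> where "bij_betw \<theta> X Y" "\<And>x. x \<in> X \<Longrightarrow> \<theta> (f x) = g (\<theta> x)"
proof -
  interpret A: inflation X f Z F \<iota> m by fact
  interpret B: inflation Y g W H \<kappa> m by fact
  have psi_W: "\<psi> z \<in> W" if "z \<in> Z" for z using psi that by (auto simp: bij_betw_def)
  have FZ: "F ` Z \<subseteq> Z" using A.range A.\<iota>_closed by fastforce
  have "\<psi> ` F ` Z = H ` \<psi> ` Z" using conj by (auto simp: image_image)
  then have img: "\<psi> ` F ` Z = H ` W" using psi by (simp add: bij_betw_def)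
  have "bij_betw \<psi> (F ` Z) (H ` W)"
    using psi FZ img inj_on_subset[of \<psi> Z "F ` Z"] by (auto simp: bij_betw_def)
  then obtain \<theta> where theta: "bij_betw \<theta> (f ` X) (g ` Y)"
    and lift: "\<And>x. x \<in> f ` X \<Longrightarrow> \<kappa> (\<theta> x) = \<psi> (\<iota> x)"
    using bij_betw_lift[OF A.bij_image B.bij_image] by blast
  have mem: "\<theta> x \<in> Y" "\<theta> x \<in> g ` Y" if "x \<in> f ` X" for x
  proof -
    show "\<theta> x \<in> g ` Y" using theta that unfolding bij_betw_def by blast
    then show "\<theta> x \<in> Y" using B.f_closed by auto
  qed
  have inj: "\<theta> x = \<theta> y \<longleftrightarrow> x = y" if "x \<in> f ` X" "y \<in> f ` X" for x y
    using theta that by (auto simp: bij_betw_def dest: inj_onD)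
  have inX: "x \<in> X" if "x \<in> f ` X" for x using that A.f_closed by blast
  have theta_conj: "\<theta> (f x) = g (\<theta> x)" if x: "x \<in> f ` X" for x
  proof -
    have "\<kappa> (\<theta> (f x)) = \<psi> (F (\<iota> x))" using lift inX[OF x] A.semiconj by simp
    also have "\<dots> = H (\<kappa> (\<theta> x))" using conj A.\<iota>_closed inX[OF x] lift[OF x] by simp
    also have "\<dots> = \<kappa> (g (\<theta> x))" using B.semiconj mem x by simp
    finally show ?thesis
      using inj_on_eq_iff[OF B.inj] mem(1)[OF imageI[OF inX[OF x]]] B.f_closed[OF mem(1)[OF x]] by blast
  qed
  have fibre: "card {x \<in> X. f x = a} = card {y \<in> Y. g y = \<theta> a}" if a: "a \<in> f ` X" for a
  proof -
    have "bij_betw \<psi> {z \<in> Z. F z = \<iota> a} {w \<in> W. H w = \<kappa> (\<theta> a)}"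
    proof (rule bij_betw_restrict_pred[OF psi])
      fix z assume z: "z \<in> Z"
      have "H (\<psi> z) = \<kappa> (\<theta> a) \<longleftrightarrow> \<psi> (F z) = \<psi> (\<iota> a)" using z a conj lift by simp
      then show "H (\<psi> z) = \<kappa> (\<theta> a) \<longleftrightarrow> F z = \<iota> a"
        using inj_on_eq_iff[OF bij_betw_imp_inj_on[OF psi], of "F z" "\<iota> a"] z FZ
          A.\<iota>_closed[OF inX[OF a]] by blast
    qed
    then have "m * card {x \<in> X. f x = a} = m * card {y \<in> Y. g y = \<theta> a}"
      using A.card_fibre[OF inX[OF a]] B.card_fibre[OF mem(1)[OF a]] bij_betw_same_card by fastforce
    then show ?thesis using A.m_pos by simp
  qed
  have core: "card {x \<in> f ` X. f x = a} = card {y \<in> g ` Y. g y = \<theta> a}" if a: "a \<in> f ` X" for a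
  proof -
    have "bij_betw \<theta> {x \<in> f ` X. f x = a} {y \<in> g ` Y. g y = \<theta> a}"
    proof (rule bij_betw_restrict_pred[OF theta])
      fix x assume x: "x \<in> f ` X"
      then have "f x \<in> f ` X" using inX by blast
      then show "g (\<theta> x) = \<theta> a \<longleftrightarrow> f x = a" using theta_conj[OF x] inj a by metis
    qed
    then show ?thesis by (rule bij_betw_same_card)
  qed
  have "card {x \<in> X - f ` X. \<theta> (f x) = b} = card {y \<in> Y - g ` Y. g y = b}" for b
  proof (cases "b \<in> g ` Y")
    case True
    then obtain a where a: "a \<in> f ` X" "b = \<theta> a" using theta unfolding bij_betw_def by blast
    then have "{x \<in> X - f ` X. \<theta> (f x) = b} = {x \<in> X - f ` X. f x = a}" using inj by auto
    then show ?thesis using A.card_leaves B.card_leaves fibre core a by simp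
  next
    case False
    then have "{x \<in> X - f ` X. \<theta> (f x) = b} = {}" "{y \<in> Y - g ` Y. g y = b} = {}" using mem by auto
    then show ?thesis by (simp only: card.empty)
  qed
  then obtain h where h: "bij_betw h (X - f ` X) (Y - g ` Y)"
    and hg: "\<And>x. x \<in> X - f ` X \<Longrightarrow> g (h x) = \<theta> (f x)"
    using fibrewise_bij[of "X - f ` X" "Y - g ` Y" "\<lambda>x. \<theta> (f x)" g] A.finite_X B.finite_X by blast
  have "bij_betw (\<lambda>x. if x \<in> f ` X then \<theta> x else h x) (f ` X \<union> (X - f ` X)) (g ` Y \<union> (Y - g ` Y))"
    using theta h by (rule bij_betw_disjoint_Un) auto
  moreover have "f ` X \<union> (X - f ` X) = X" "g ` Y \<union> (Y - g ` Y) = Y" using A.f_closed B.f_closed by auto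
  ultimately have "bij_betw (\<lambda>x. if x \<in> f ` X then \<theta> x else h x) X Y" by simp
  moreover have "(if f x \<in> f ` X then \<theta> (f x) else h (f x)) = g (if x \<in> f ` X then \<theta> x else h x)"
    if "x \<in> X" for x
    using theta_conj hg that by auto
  ultimately show thesis using that by blast
qed

lemma power_map_digraph_iso_iff:
  assumes "group G" "group H"
  shows "digraph_iso (with_proj (power_map_digraph t G)) (with_proj (power_map_digraph t H)) \<longleftrightarrow>
    (\<exists>f. bij_betw f (carrier G) (carrier H) \<and>
      (\<forall>x \<in> carrier G. f (x [^]\<^bsub>G\<^esub> t) = f x [^]\<^bsub>H\<^esub> t))"
proof -
  interpret G: group G by fact
  interpret H: group H by fact
  have "(\<forall>u \<in> carrier G. \<forall>v \<in> carrier G. (f u, f v) \<in> parcs (power_map_digraph t H) \<longleftrightarrow>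
      (u, v) \<in> parcs (power_map_digraph t G)) \<longleftrightarrow>
    (\<forall>x \<in> carrier G. f (x [^]\<^bsub>G\<^esub> t) = f x [^]\<^bsub>H\<^esub> t)"
    if f: "bij_betw f (carrier G) (carrier H)" for f
  proof -
    have cl: "f x \<in> carrier H" if "x \<in> carrier G" for x using f that by (auto simp: bij_betw_def)
    have eq: "f x = f y \<longleftrightarrow> x = y" if "x \<in> carrier G" "y \<in> carrier G" for x y
      using f that by (auto simp: bij_betw_def dest: inj_onD)
    have "(\<forall>u \<in> carrier G. \<forall>v \<in> carrier G. (f u, f v) \<in> parcs (power_map_digraph t H) \<longleftrightarrow>
      (u, v) \<in> parcs (power_map_digraph t G)) \<longleftrightarrow>
      (\<forall>u \<in> carrier G. \<forall>v \<in> carrier G. f v = f u [^]\<^bsub>H\<^esub> t \<longleftrightarrow> v = u [^]\<^bsub>G\<^esub> t)"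
      by (intro ball_cong refl) (auto simp: power_map_digraph_def cl)
    also have "\<dots> \<longleftrightarrow> (\<forall>u \<in> carrier G. f (u [^]\<^bsub>G\<^esub> t) = f u [^]\<^bsub>H\<^esub> t)"
      using eq G.int_pow_closed by metis
    finally show ?thesis .
  qed
  moreover have "pverts (power_map_digraph t G) = carrier G" "pverts (power_map_digraph t H) = carrier H"
    by (simp_all add: power_map_digraph_def)
  ultimately show ?thesis
    unfolding digraph_iso_with_proj_iff[OF G.wf_power_map_digraph H.wf_power_map_digraph]
    by (metis (lifting))
qed

lemma int_pow_DirProd:
  assumes "group G" "group H" "x \<in> carrier G" "y \<in> carrier H"
  shows "(x, y) [^]\<^bsub>G \<times>\<times> H\<^esub> (k::int) = (x [^]\<^bsub>G\<^esub> k, y [^]\<^bsub>H\<^esub> k)"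
proof -
  have GH: "group (G \<times>\<times> H)" using assms DirProd_group by blast
  have mem: "(x, y) \<in> carrier (G \<times>\<times> H)" using assms by simp
  have "fst \<in> hom (G \<times>\<times> H) G" "snd \<in> hom (G \<times>\<times> H) H" by (auto simp: hom_def)
  then have "fst ((x, y) [^]\<^bsub>G \<times>\<times> H\<^esub> k) = x [^]\<^bsub>G\<^esub> k" "snd ((x, y) [^]\<^bsub>G \<times>\<times> H\<^esub> k) = y [^]\<^bsub>H\<^esub> k"
    using hom_int_pow[of fst "G \<times>\<times> H" G "(x, y)" k] hom_int_pow[of snd "G \<times>\<times> H" H "(x, y)" k] assms GH mem by auto
  then show ?thesis by (metis prod.collapse)
qed

lemma (in finite_group) int_pow_cong_order:
  assumes "[s = t] (mod int (order G))" "x \<in> carrier G"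
  shows "x [^] (s::int) = x [^] t"
proof -
  have "int (ord x) dvd int (order G)" using ord_dvd_group_order assms by simp
  moreover have "int (order G) dvd t - s" using assms(1) cong_iff_dvd_diff cong_sym by blast
  ultimately show ?thesis using int_pow_eq assms(2) dvd_trans by blast
qed

lemma (in finite_group) eq_one_of_coprime_pow:
  assumes "x \<in> carrier G" "x [^] (n::nat) = \<one>" "coprime n (order G)"
  shows "x = \<one>"
proof -
  have "ord x dvd n" "ord x dvd order G" using assms pow_eq_id ord_dvd_group_order by auto
  then have "ord x = 1" using assms(3) by (metis coprime_common_divisor nat_dvd_1_iff_1)
  then show ?thesis using ord_eq_1 assms by blast
qed

section \<open>Direct products of coprime order\<close>

locale coprime_finite_groups = G1: finite_group G1 + G2: finite_group G2
  for G1 :: "('a, 'm) monoid_scheme" and G2 :: "('b, 'n) monoid_scheme" +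
  assumes coprime: "coprime (order G1) (order G2)"
begin

lemma groups: "group G1" "group G2"
  by (simp_all add: G1.is_group G2.is_group)

sublocale prod: finite_group "G1 \<times>\<times> G2"
  by (intro finite_group.intro finite_group_axioms.intro DirProd_group groups) simp

lemma order_prod: "order (G1 \<times>\<times> G2) = order G1 * order G2"
  by (simp add: order_def card_cartesian_product)

lemma nat_pow_prod:
  "a \<in> carrier G1 \<Longrightarrow> b \<in> carrier G2 \<Longrightarrow> (a, b) [^]\<^bsub>G1 \<times>\<times> G2\<^esub> (k::nat) = (a [^]\<^bsub>G1\<^esub> k, b [^]\<^bsub>G2\<^esub> k)"
  using int_pow_DirProd[OF groups, of a b "int k"] by (simp add: int_pow_int)

sublocale left: torsion_embedding G1 "G1 \<times>\<times> G2" "\<lambda>a. (a, \<one>\<^bsub>G2\<^esub>)" "order G1"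
proof unfold_locales
  show "(\<lambda>a. (a, \<one>\<^bsub>G2\<^esub>)) ` carrier G1 =
      {x \<in> carrier (G1 \<times>\<times> G2). x [^]\<^bsub>G1 \<times>\<times> G2\<^esub> order G1 = \<one>\<^bsub>G1 \<times>\<times> G2\<^esub>}"
    using G2.eq_one_of_coprime_pow[OF _ _ coprime] by (auto simp: nat_pow_prod G1.pow_order_eq_1)
qed (auto simp: hom_def inj_on_def)

sublocale right: torsion_embedding G2 "G1 \<times>\<times> G2" "\<lambda>b. (\<one>\<^bsub>G1\<^esub>, b)" "order G2"
proof unfold_locales
  have "coprime (order G2) (order G1)" using coprime by (simp add: coprime_commute)
  then show "(\<lambda>b. (\<one>\<^bsub>G1\<^esub>, b)) ` carrier G2 =
      {x \<in> carrier (G1 \<times>\<times> G2). x [^]\<^bsub>G1 \<times>\<times> G2\<^esub> order G2 = \<one>\<^bsub>G1 \<times>\<times> G2\<^esub>}"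
    using G1.eq_one_of_coprime_pow by (auto simp: nat_pow_prod G2.pow_order_eq_1)
qed (auto simp: hom_def inj_on_def)

text \<open>By the Chinese remainder theorem there is an exponent \<open>s\<close> that acts as \<open>t\<close>
on the first factor and collapses the second factor to its identity.\<close>
lemma inflation_left:
  assumes s: "[s = t] (mod int (order G1))" "[s = 0] (mod int (order G2))"
  shows "inflation (carrier G1) (\<lambda>x. x [^]\<^bsub>G1\<^esub> t) (carrier (G1 \<times>\<times> G2)) (\<lambda>x. x [^]\<^bsub>G1 \<times>\<times> G2\<^esub> s)
    (\<lambda>a. (a, \<one>\<^bsub>G2\<^esub>)) (order G2)"
proof -
  have pow: "(a, b) [^]\<^bsub>G1 \<times>\<times> G2\<^esub> s = (a [^]\<^bsub>G1\<^esub> t, \<one>\<^bsub>G2\<^esub>)" if "a \<in> carrier G1" "b \<in> carrier G2" for a b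
    using that int_pow_DirProd[OF groups] G1.int_pow_cong_order[OF s(1)] G2.int_pow_cong_order[OF s(2)] by simp
  have "{z \<in> carrier (G1 \<times>\<times> G2). z [^]\<^bsub>G1 \<times>\<times> G2\<^esub> s = (a, \<one>\<^bsub>G2\<^esub>)} =
      {x \<in> carrier G1. x [^]\<^bsub>G1\<^esub> t = a} \<times> carrier G2" for a
    by (auto simp: pow)
  then have "card {z \<in> carrier (G1 \<times>\<times> G2). z [^]\<^bsub>G1 \<times>\<times> G2\<^esub> s = (a, \<one>\<^bsub>G2\<^esub>)} =
      order G2 * card {x \<in> carrier G1. x [^]\<^bsub>G1\<^esub> t = a}" for a
    by (simp add: card_cartesian_product order_def)
  then show ?thesis
    using pow by unfold_locales (auto simp: inj_on_def G2.order_gt_0_iff_finite)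
qed

lemma inflation_right:
  assumes s: "[s = 0] (mod int (order G1))" "[s = t] (mod int (order G2))"
  shows "inflation (carrier G2) (\<lambda>x. x [^]\<^bsub>G2\<^esub> t) (carrier (G1 \<times>\<times> G2)) (\<lambda>x. x [^]\<^bsub>G1 \<times>\<times> G2\<^esub> s)
    (\<lambda>b. (\<one>\<^bsub>G1\<^esub>, b)) (order G1)"
proof -
  have pow: "(a, b) [^]\<^bsub>G1 \<times>\<times> G2\<^esub> s = (\<one>\<^bsub>G1\<^esub>, b [^]\<^bsub>G2\<^esub> t)" if "a \<in> carrier G1" "b \<in> carrier G2" for a b
    using that int_pow_DirProd[OF groups] G1.int_pow_cong_order[OF s(1)] G2.int_pow_cong_order[OF s(2)] by simp
  have "{z \<in> carrier (G1 \<times>\<times> G2). z [^]\<^bsub>G1 \<times>\<times> G2\<^esub> s = (\<one>\<^bsub>G1\<^esub>, b)} =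
      carrier G1 \<times> {x \<in> carrier G2. x [^]\<^bsub>G2\<^esub> t = b}" for b
    by (auto simp: pow)
  then have "card {z \<in> carrier (G1 \<times>\<times> G2). z [^]\<^bsub>G1 \<times>\<times> G2\<^esub> s = (\<one>\<^bsub>G1\<^esub>, b)} =
      order G1 * card {x \<in> carrier G2. x [^]\<^bsub>G2\<^esub> t = b}" for b
    by (simp add: card_cartesian_product order_def)
  then show ?thesis
    using pow by unfold_locales (auto simp: inj_on_def G1.order_gt_0_iff_finite)
qed

end

lemma power_map_digraph_factors:
  assumes "coprime_finite_groups G1 G2" "coprime_finite_groups H1 H2"
    and ord: "order G1 = order H1" "order G2 = order H2"
    and iso: "\<And>s::int. digraph_iso (with_proj (power_map_digraph s (G1 \<times>\<times> G2)))
      (with_proj (power_map_digraph s (H1 \<times>\<times> H2)))"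
  shows "digraph_iso (with_proj (power_map_digraph t G1)) (with_proj (power_map_digraph t H1))"
    and "digraph_iso (with_proj (power_map_digraph t G2)) (with_proj (power_map_digraph t H2))"
proof -
  interpret G: coprime_finite_groups G1 G2 by fact
  interpret H: coprime_finite_groups H1 H2 by fact
  have cop: "coprime (int (order G1)) (int (order G2))" using G.coprime by simp
  have conj: "\<exists>\<psi>. bij_betw \<psi> (carrier (G1 \<times>\<times> G2)) (carrier (H1 \<times>\<times> H2)) \<and>
      (\<forall>z \<in> carrier (G1 \<times>\<times> G2). \<psi> (z [^]\<^bsub>G1 \<times>\<times> G2\<^esub> s) = \<psi> z [^]\<^bsub>H1 \<times>\<times> H2\<^esub> s)" for s :: int
    using iso[of s] power_map_digraph_iso_iff[OF G.prod.is_group H.prod.is_group] by blast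
  obtain s where s: "[s = t] (mod int (order G1))" "[s = 0] (mod int (order G2))"
    using binary_chinese_remainder_int[OF cop] by blast
  obtain \<psi> where psi: "bij_betw \<psi> (carrier (G1 \<times>\<times> G2)) (carrier (H1 \<times>\<times> H2))"
    "\<And>z. z \<in> carrier (G1 \<times>\<times> G2) \<Longrightarrow> \<psi> (z [^]\<^bsub>G1 \<times>\<times> G2\<^esub> s) = \<psi> z [^]\<^bsub>H1 \<times>\<times> H2\<^esub> s" using conj[of s] by blast
  show "digraph_iso (with_proj (power_map_digraph t G1)) (with_proj (power_map_digraph t H1))"
  proof -
    \<comment> \<open>Equal group orders turn the congruences on \<open>s\<close> and the multiplicity into
      those for the other product.\<close>
    have H: "inflation (carrier H1) (\<lambda>x. x [^]\<^bsub>H1\<^esub> t) (carrier (H1 \<times>\<times> H2)) (\<lambda>x. x [^]\<^bsub>H1 \<times>\<times> H2\<^esub> s)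
        (\<lambda>a. (a, \<one>\<^bsub>H2\<^esub>)) (order G2)"
      using H.inflation_left[of s t] s ord by simp
    obtain \<theta> where "bij_betw \<theta> (carrier G1) (carrier H1)"
      "\<And>x. x \<in> carrier G1 \<Longrightarrow> \<theta> (x [^]\<^bsub>G1\<^esub> t) = \<theta> x [^]\<^bsub>H1\<^esub> t"
      using inflation_conjugacy_cancel[OF G.inflation_left[OF s] H psi] by blast
    then show ?thesis
      unfolding power_map_digraph_iso_iff[OF G.groups(1) H.groups(1)] by blast
  qed
  obtain r where r: "[r = 0] (mod int (order G1))" "[r = t] (mod int (order G2))"
    using binary_chinese_remainder_int[OF cop] by blast
  obtain \<phi> where phi: "bij_betw \<phi> (carrier (G1 \<times>\<times> G2)) (carrier (H1 \<times>\<times> H2))"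
    "\<And>z. z \<in> carrier (G1 \<times>\<times> G2) \<Longrightarrow> \<phi> (z [^]\<^bsub>G1 \<times>\<times> G2\<^esub> r) = \<phi> z [^]\<^bsub>H1 \<times>\<times> H2\<^esub> r" using conj[of r] by blast
  show "digraph_iso (with_proj (power_map_digraph t G2)) (with_proj (power_map_digraph t H2))"
  proof -
    have H: "inflation (carrier H2) (\<lambda>x. x [^]\<^bsub>H2\<^esub> t) (carrier (H1 \<times>\<times> H2)) (\<lambda>x. x [^]\<^bsub>H1 \<times>\<times> H2\<^esub> r)
        (\<lambda>b. (\<one>\<^bsub>H1\<^esub>, b)) (order G1)"
      using H.inflation_right[of r t] r ord by simp
    obtain \<theta> where "bij_betw \<theta> (carrier G2) (carrier H2)"
      "\<And>x. x \<in> carrier G2 \<Longrightarrow> \<theta> (x [^]\<^bsub>G2\<^esub> t) = \<theta> x [^]\<^bsub>H2\<^esub> t"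
      using inflation_conjugacy_cancel[OF G.inflation_right[OF r] H phi] by blast
    then show ?thesis
      unfolding power_map_digraph_iso_iff[OF G.groups(2) H.groups(2)] by blast
  qed
qed

theorem theorem2p11:
  fixes G1 :: "('a, 'm) monoid_scheme" and G2 :: "('b, 'n) monoid_scheme"
    and H1 :: "('c, 'k) monoid_scheme" and H2 :: "('d, 'l) monoid_scheme"
    and j :: nat
  assumes "1 \<le> j" and "j \<le> 6"
    and "group G1" and "finite (carrier G1)"
    and "group G2" and "finite (carrier G2)"
    and "group H1" and "finite (carrier H1)"
    and "group H2" and "finite (carrier H2)"
    and "group_sim j (G1 \<times>\<times> G2) (H1 \<times>\<times> H2)"
    and "order G1 = order H1" and "order G2 = order H2"
    and "gcd (order G1) (order G2) = 1"
  shows "group_sim j G1 H1 \<and> group_sim j G2 H2"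
proof -
  have cop: "coprime (order G1) (order G2)" using assms(14) coprime_iff_gcd_eq_1 by blast
  interpret G: coprime_finite_groups G1 G2
    using assms cop by (intro coprime_finite_groups.intro finite_group.intro finite_group_axioms.intro
        coprime_finite_groups_axioms.intro)
  interpret H: coprime_finite_groups H1 H2
    using assms cop by (intro coprime_finite_groups.intro finite_group.intro finite_group_axioms.intro
        coprime_finite_groups_axioms.intro) simp_all
  interpret left: torsion_embedding_pair G1 "G1 \<times>\<times> G2" H1 "H1 \<times>\<times> H2"
    "\<lambda>a. (a, \<one>\<^bsub>G2\<^esub>)" "\<lambda>a. (a, \<one>\<^bsub>H2\<^esub>)" "order G1"
    using G.left.torsion_embedding_axioms H.left.torsion_embedding_axioms assms(12)
    by (simp add: torsion_embedding_pair_def)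
  interpret right: torsion_embedding_pair G2 "G1 \<times>\<times> G2" H2 "H1 \<times>\<times> H2"
    "\<lambda>b. (\<one>\<^bsub>G1\<^esub>, b)" "\<lambda>b. (\<one>\<^bsub>H1\<^esub>, b)" "order G2"
    using G.right.torsion_embedding_axioms H.right.torsion_embedding_axioms assms(13)
    by (simp add: torsion_embedding_pair_def)
  have ordG: "order (G1 \<times>\<times> G2) = order G1 * order G2" "order (G1 \<times>\<times> G2) = order G2 * order G1"
    using G.order_prod by simp_all
  have ordH: "order (H1 \<times>\<times> H2) = order G1 * order G2" "order (H1 \<times>\<times> H2) = order G2 * order G1"
    using H.order_prod assms(12,13) by simp_all
  have cop': "coprime (order G2) (order G1)" using cop by (simp add: coprime_commute)
  note sim = assms(11)[unfolded group_sim_def]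
  consider "j = 1" | "j = 2" | "j = 3" | "j = 4" | "j = 5" | "j = 6" using assms(1,2) by linarith
  then show ?thesis
  proof cases
    case 1
    then show ?thesis using sim left.iso_restrict right.iso_restrict by (simp add: group_sim_def)
  next
    case 2
    then show ?thesis using sim left.power_equivalent_restrict right.power_equivalent_restrict
      by (simp add: group_sim_def)
  next
    case 3
    then show ?thesis
      using sim left.cyclic_subgroup_digraph_restrict right.cyclic_subgroup_digraph_restrict
      by (simp add: group_sim_def)
  next
    case 4
    then show ?thesis
      using sim left.power_graph_restrict[OF ordG(1) ordH(1) cop] right.power_graph_restrict[OF ordG(2) ordH(2) cop']
      by (simp add: group_sim_def)
  next
    case 5
    then show ?thesis
      using sim power_map_digraph_factors[OF G.coprime_finite_groups_axioms H.coprime_finite_groups_axioms assms(12,13)]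
      by (simp add: group_sim_def)
  next
    case 6
    then show ?thesis using sim left.order_multiset_restrict right.order_multiset_restrict
      by (simp add: group_sim_def)
  qed
qed

end
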